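(* Let $\nu$ be a random variable with values in $\{1,2,\ldots\}$ such that $\mathbb{E}(t^\nu)<\infty$ for some $t>1$, and $m:=\mathbb{E}(\nu)>1$. Let $\theta\in(0,\log m)$. Let $Y_0$ be a random variable with values in $(0,\infty)$ for which there exist constants $0<c_1\le c_2<\infty$ such that for all sufficiently large $x$, $$c_1\,\mathrm{e}^{-\theta x}\le \mathbb{P}(Y_0\ge x)\le c_2\,\mathrm{e}^{-\theta x}.$$ For $p\in[0,1]$, let $F_\infty(p)$ be the free energy of the recursive model with offspring variable $\nu$ and initial law $(1-p)\delta_0+pP_{Y_0}$. Then $$F_\infty(p)=p^{\beta+o(1)},\qquad p\downarrow 0,$$ where $\beta=\beta(\theta):=\frac{\log m}{(\log m)-\theta}$ and $o(1)$ denotes a function of $p$ tending to $0$ as $p\downarrow 0$.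
   Context: The model: $\nu$ takes values in $\{1,2,\ldots\}$ with $m:=\mathbb{E}(\nu)\in(1,\infty)$. Let $Y_0$ be a random variable with values in $(0,\infty)$, $P_{Y_0}$ its law, $\delta_0$ the Dirac measure at $0$, and $p\in[0,1]$. The random variable $X_0\ge 0$ has law $(1-p)\delta_0+pP_{Y_0}$, and the laws of $X_n$ are defined recursively by: for all $n\ge 0$, $$X_{n+1}\ \overset{\mathrm{law}}{=}\ (X_{n,1}+\cdots+X_{n,\nu}-1)^+,$$ where $X_{n,1},X_{n,2},\ldots$ are independent copies of $X_n$, independent of $\nu$, and $a^+:=\max\{a,0\}$. The free energy is $F_\infty(p):=\lim_{n\to\infty}\mathbb{E}(X_n)/m^n$, where the sequence $\mathbb{E}(X_n)/m^n$ is non-increasing in $n$. *)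

theory Defs
  imports "HOL-Probability.Probability"
begin

text \<open>
  The recursion determines only the law of each \<open>X\<^sub>n\<close>, so the model is defined on laws:
  \<open>N\<close> is the law of \<open>\<nu>\<close> on the natural numbers, \<open>Q\<close> the law of \<open>Y\<^sub>0\<close> on the reals.
\<close>

text \<open>The mixture \<open>(1 - p) \<delta>\<^sub>0 + p Q\<close>; only meaningful for \<open>p \<in> [0,1]\<close>.\<close>

definition initial_law :: "real \<Rightarrow> real measure \<Rightarrow> real measure" where
  "initial_law p Q = measure_of UNIV (sets borel)
     (\<lambda>A. ennreal (1 - p) * emeasure (return borel 0) A + ennreal p * emeasure Q A)"

text \<open>
  The law of \<open>(\<xi>\<^sub>0 + \<dots> + \<xi>\<^bsub>\<nu>-1\<^esub> - 1)\<^sup>+\<close> on the canonical product space, where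
  \<open>\<nu>\<close> and the sequence \<open>\<xi>\<close> of independent variables of law \<open>\<mu>\<close> are the coordinates.
\<close>

definition step_law :: "nat measure \<Rightarrow> real measure \<Rightarrow> real measure" where
  "step_law N \<mu> = distr (N \<Otimes>\<^sub>M (\<Pi>\<^sub>M i\<in>(UNIV :: nat set). \<mu>)) borel
     (\<lambda>(k, x). max ((\<Sum>i<k. x i) - 1) 0)"

primrec law_X :: "nat measure \<Rightarrow> real measure \<Rightarrow> real \<Rightarrow> nat \<Rightarrow> real measure" where
  "law_X N Q p 0 = initial_law p Q"
| "law_X N Q p (Suc n) = step_law N (law_X N Q p n)"

definition free_energy :: "nat measure \<Rightarrow> real measure \<Rightarrow> real \<Rightarrow> real" where
  "free_energy N Q p =
     lim (\<lambda>n. (\<integral>x. x \<partial>law_X N Q p n) / (\<integral>k. real k \<partial>N) ^ n)"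

lemma space_initial_law [simp]: "space (initial_law p Q) = UNIV"
  and sets_initial_law [simp, measurable_cong]: "sets (initial_law p Q) = sets borel"
  unfolding initial_law_def
  by (simp_all add: space_measure_of_conv sigma_algebra.sigma_sets_eq
        [OF sets.sigma_algebra_axioms[of "borel :: real measure", simplified]])

lemma emeasure_initial_law:
  assumes Q: "sets Q = sets borel" and A: "A \<in> sets borel"
  shows "emeasure (initial_law p Q) A =
    ennreal (1 - p) * emeasure (return borel 0) A + ennreal p * emeasure Q A"
  using initial_law_def
proof (rule emeasure_measure_of)
  show "positive (sets (initial_law p Q))
     (\<lambda>A. ennreal (1 - p) * emeasure (return borel 0) A + ennreal p * emeasure Q A)"
    by (simp add: positive_def)
  show "countably_additive (sets (initial_law p Q))
     (\<lambda>A. ennreal (1 - p) * emeasure (return borel 0) A + ennreal p * emeasure Q A)"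
  proof (rule countably_additiveI)
    fix B :: "nat \<Rightarrow> real set"
    assume B: "range B \<subseteq> sets (initial_law p Q)" "disjoint_family B"
    have "(\<Sum>i. emeasure (return borel 0) (B i)) = emeasure (return borel 0) (\<Union>i. B i)"
      by (rule suminf_emeasure) (use B in auto)
    moreover have "(\<Sum>i. emeasure Q (B i)) = emeasure Q (\<Union>i. B i)"
      by (rule suminf_emeasure) (use B Q in auto)
    ultimately show "(\<Sum>i. ennreal (1 - p) * emeasure (return borel 0) (B i) +
          ennreal p * emeasure Q (B i)) =
        ennreal (1 - p) * emeasure (return borel 0) (\<Union>i. B i) + ennreal p * emeasure Q (\<Union>i. B i)"
      by (simp add: suminf_add[symmetric] ennreal_suminf_cmult)
  qed
qed (use A in \<open>auto\<close>)

lemma prob_space_initial_law: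
  assumes "prob_space Q" "sets Q = sets borel" "0 \<le> p" "p \<le> 1"
  shows "prob_space (initial_law p Q)"
proof (rule prob_spaceI)
  have "space Q = UNIV"
    using assms(2) sets_eq_imp_space_eq by fastforce
  then have "emeasure Q UNIV = 1"
    using prob_space.emeasure_space_1[OF assms(1)] by simp
  then show "emeasure (initial_law p Q) (space (initial_law p Q)) = 1"
    using assms by (simp add: emeasure_initial_law flip: ennreal_plus)
qed

lemma measurable_step:
  assumes "sets N = sets (count_space UNIV)" "sets \<mu> = sets borel"
  shows "(\<lambda>(k, x). max ((\<Sum>i<k. x i) - 1) 0) \<in>
    N \<Otimes>\<^sub>M (\<Pi>\<^sub>M i\<in>(UNIV :: nat set). \<mu>) \<rightarrow>\<^sub>M (borel :: real measure)"
proof -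
  have *: "(\<lambda>x. x i) \<in> (\<Pi>\<^sub>M i\<in>(UNIV :: nat set). \<mu>) \<rightarrow>\<^sub>M (borel :: real measure)" for i
    using measurable_component_singleton[of i UNIV "\<lambda>_. \<mu>"]
    unfolding measurable_cong_sets[OF refl assms(2)] by blast
  have "(\<lambda>(k, x). max ((\<Sum>i<k. x i) - 1) 0) \<in>
    count_space UNIV \<Otimes>\<^sub>M (\<Pi>\<^sub>M i\<in>(UNIV :: nat set). \<mu>) \<rightarrow>\<^sub>M (borel :: real measure)"
    using * by (intro measurable_pair_measure_countable1) auto
  then show ?thesis
    using measurable_cong_sets[OF sets_pair_measure_cong[OF assms(1) refl] refl] by metis
qed

lemma prob_space_law_X:
  assumes "prob_space N" "sets N = sets (count_space UNIV)"
    and "prob_space Q" "sets Q = sets borel" "0 \<le> p" "p \<le> 1"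
  shows "prob_space (law_X N Q p n) \<and> sets (law_X N Q p n) = sets borel"
proof (induction n)
  case 0
  then show ?case by (simp add: prob_space_initial_law assms)
next
  case (Suc n)
  have "prob_space (\<Pi>\<^sub>M i\<in>(UNIV :: nat set). law_X N Q p n)"
    using Suc by (intro prob_space_PiM) simp
  then have "prob_space (N \<Otimes>\<^sub>M (\<Pi>\<^sub>M i\<in>(UNIV :: nat set). law_X N Q p n))"
    using assms(1) by (rule prob_space_pair[rotated])
  then show ?case
    using Suc prob_space.prob_space_distr[OF _ measurable_step[OF assms(2), of "law_X N Q p n"]]
    by (simp add: step_law_def)
qed

text \<open>The canonical space is immaterial: any independent copies, independent of \<open>\<nu>\<close>, give the
  same law.\<close>

lemma (in prob_space) step_law_eq_distr:
  fixes X :: "nat \<Rightarrow> 'a \<Rightarrow> real" and \<nu> :: "'a \<Rightarrow> nat"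
  assumes \<nu>: "distr M (count_space UNIV) \<nu> = N"
    and X: "\<And>i. distr M borel (X i) = \<mu>" "indep_vars (\<lambda>_. borel) X UNIV"
    and ind: "indep_set {\<nu> -` A \<inter> space M | A. True}
               {(\<lambda>\<omega> i. X i \<omega>) -` B \<inter> space M | B. B \<in> sets (\<Pi>\<^sub>M i\<in>UNIV. borel)}"
  shows "step_law N \<mu> = distr M borel (\<lambda>\<omega>. max ((\<Sum>i<\<nu> \<omega>. X i \<omega>) - 1) 0)"
proof -
  have mX: "random_variable borel (X i)" for i
    using X(2) by (simp add: indep_vars_def)
  have sets: "sets N = sets (count_space UNIV)" "sets \<mu> = sets borel"
    by (simp_all flip: \<nu> X(1)[of 0])
  let ?P = "\<Pi>\<^sub>M i\<in>(UNIV :: nat set). (borel :: real measure)" and ?X = "\<lambda>\<omega> i. X i \<omega>"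
  have m\<nu>: "\<nu> \<in> M \<rightarrow>\<^sub>M count_space UNIV"
  proof (rule measurableI)
    fix A :: "nat set" show "\<nu> -` A \<inter> space M \<in> sets M"
      using ind by (auto simp: indep_set_def indep_sets_def split: bool.splits)
  qed simp
  have mXs: "?X \<in> M \<rightarrow>\<^sub>M ?P"
    using mX by (intro measurable_PiM_single') auto
  have dX: "distr M ?P ?X = (\<Pi>\<^sub>M i\<in>UNIV. \<mu>)"
    using X(2) indep_vars_iff_distr_eq_PiM[of UNIV X "\<lambda>_. borel"] mX
    by (simp add: X(1) restrict_def)
  interpret N: prob_space N
    using prob_space_distr[OF m\<nu>] \<nu> by simp
  interpret P: prob_space "\<Pi>\<^sub>M i\<in>(UNIV :: nat set). \<mu>"
    using prob_space_distr[OF mXs] dX by simp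
  have setsP: "sets (\<Pi>\<^sub>M i\<in>(UNIV :: nat set). \<mu>) = sets ?P"
    using dX by (metis sets_distr)
  have "N \<Otimes>\<^sub>M (\<Pi>\<^sub>M i\<in>UNIV. \<mu>) = distr M (count_space UNIV \<Otimes>\<^sub>M ?P) (\<lambda>\<omega>. (\<nu> \<omega>, ?X \<omega>))"
  proof (rule pair_measure_eqI)
    fix A B assume "A \<in> sets N" and B': "B \<in> sets (\<Pi>\<^sub>M i\<in>(UNIV :: nat set). \<mu>)"
    have B: "B \<in> sets ?P" using B' setsP by simp
    have mA: "\<nu> -` A \<inter> space M \<in> events" and mB: "?X -` B \<inter> space M \<in> events"
      using measurable_sets[OF m\<nu>, of A] measurable_sets[OF mXs B] by auto
    have "emeasure N A = prob (\<nu> -` A \<inter> space M)"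
      using m\<nu> by (simp add: \<nu>[symmetric] emeasure_distr emeasure_eq_measure)
    moreover have "emeasure (\<Pi>\<^sub>M i\<in>UNIV. \<mu>) B = prob (?X -` B \<inter> space M)"
      using mXs B by (simp add: dX[symmetric] emeasure_distr emeasure_eq_measure)
    moreover have "emeasure (distr M (count_space UNIV \<Otimes>\<^sub>M ?P) (\<lambda>\<omega>. (\<nu> \<omega>, ?X \<omega>))) (A \<times> B) =
        prob ((\<nu> -` A \<inter> space M) \<inter> (?X -` B \<inter> space M))"
    proof -
      have "(\<lambda>\<omega>. (\<nu> \<omega>, ?X \<omega>)) -` (A \<times> B) \<inter> space M =
          (\<nu> -` A \<inter> space M) \<inter> (?X -` B \<inter> space M)" by auto
      moreover have "A \<times> B \<in> sets (count_space UNIV \<Otimes>\<^sub>M ?P)"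
        using B by (intro pair_measureI) auto
      ultimately show ?thesis
        using measurable_Pair[OF m\<nu> mXs] by (simp add: emeasure_distr emeasure_eq_measure)
    qed
    moreover have "prob ((\<nu> -` A \<inter> space M) \<inter> (?X -` B \<inter> space M)) =
        prob (\<nu> -` A \<inter> space M) * prob (?X -` B \<inter> space M)"
      by (rule indep_setD[OF ind]) (use B in auto)
    ultimately show "emeasure N A * emeasure (\<Pi>\<^sub>M i\<in>UNIV. \<mu>) B =
        emeasure (distr M (count_space UNIV \<Otimes>\<^sub>M ?P) (\<lambda>\<omega>. (\<nu> \<omega>, ?X \<omega>))) (A \<times> B)"
      by (simp add: ennreal_mult)
  qed (simp_all add: N.sigma_finite_measure_axioms P.sigma_finite_measure_axioms
        sets_pair_measure_cong[OF sets(1) setsP])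
  then have "step_law N \<mu> = distr (distr M (count_space UNIV \<Otimes>\<^sub>M ?P) (\<lambda>\<omega>. (\<nu> \<omega>, ?X \<omega>)))
      borel (\<lambda>(k, x). max ((\<Sum>i<k. x i) - 1) 0)"
    by (simp add: step_law_def)
  also have "\<dots> = distr M borel (\<lambda>\<omega>. max ((\<Sum>i<\<nu> \<omega>. X i \<omega>) - 1) 0)"
    using measurable_step[of "count_space UNIV" borel] measurable_Pair[OF m\<nu> mXs]
    by (subst distr_distr) (auto simp: comp_def)
  finally show ?thesis .
qed

end

(* E(X_n) moves by at most 1 from a geometric growth of ratio m, so F is squeezed between
   (E(X_n) - 1/(m-1)) / m^n and E(X_n) / m^n for every n, and it suffices to locate the
   generation n ~ log(1/p) / (log m - theta) at which E(X_n) becomes of order 1.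

   Before it: phi_L(x) = exp(s min(x,L)) (1 + s (x-L)^+) is submultiplicative and satisfies
   phi_{L-1}(x-1) = e^{-s} phi_L(x), so u_n = E phi_{L-n}(X_n) - 1 obeys
   u_{n+1} <= e^{-s} (f(1+u_n) - 1) with f the generating function of nu. For s > log m a
   small u_n stays small, and phi_0(x) - 1 = s x, so E(X_L) stays bounded. The start u_0 is
   of order p exp((s - theta) L), small as long as L < (1-epsilon) log(1/p) / (log m - theta).

   After it: X_n exceeds X_0 - n at each leaf, so a_n = P(X_n >= K + L - n) satisfies
   1 - a_{n+1} <= f(1 - a_n) and grows at rate close to m up to a constant level, starting
   from a_0 of order p exp(-theta L). *)
theory Submission
  imports Defs
begin

section \<open>Change of variables for the initial law, one transition, and i.i.d.
  coordinates\<close>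

section \<open>Integrals against the recursive laws\<close>

text \<open>The mixture is realised as the image of a Bernoulli choice and an independent
  \<open>Q\<close>-sample, so that Fubini applies; both measures agree on Borel sets, which
  transfers the formula to \<open>initial_law\<close>.\<close>

lemma nn_integral_initial_law:
  assumes Q: "prob_space Q" "sets Q = sets borel" and p: "0 \<le> p" "p \<le> 1"
    and g [measurable]: "g \<in> borel_measurable borel"
  shows "(\<integral>\<^sup>+x. g x \<partial>initial_law p Q) = ennreal (1 - p) * g 0 + ennreal p * (\<integral>\<^sup>+y. g y \<partial>Q)"
proof -
  interpret Q: prob_space Q by (fact Q(1))
  note Q(2) [measurable_cong]
  let ?B = "measure_pmf (bernoulli_pmf p)"
  let ?D = "distr (?B \<Otimes>\<^sub>M Q) borel (\<lambda>(b, y). if b then y else 0)"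
  have meas [measurable]: "(\<lambda>(b, y). if b then y else 0) \<in> ?B \<Otimes>\<^sub>M Q \<rightarrow>\<^sub>M (borel :: real measure)"
    by measurable
  have D: "(\<integral>\<^sup>+x. g x \<partial>?D) = ennreal (1 - p) * g 0 + ennreal p * (\<integral>\<^sup>+y. g y \<partial>Q)"
    if [measurable]: "g \<in> borel_measurable borel" for g
  proof -
    have "(\<integral>\<^sup>+x. g x \<partial>?D) = (\<integral>\<^sup>+b. \<integral>\<^sup>+y. g (if b then y else 0) \<partial>Q \<partial>?B)"
      by (simp add: nn_integral_distr Q.nn_integral_fst[symmetric])
    then show ?thesis
      using p by (simp add: Q.emeasure_space_1 algebra_simps)
  qed
  have "initial_law p Q = ?D"
  proof (rule measure_eqI)
    fix A assume "A \<in> sets (initial_law p Q)"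
    then have A: "A \<in> sets borel" by simp
    then have "emeasure ?D A = ennreal (1 - p) * indicator A 0 + ennreal p * emeasure Q A"
      using D[of "indicator A"] by (simp add: Q(2))
    then show "emeasure (initial_law p Q) A = emeasure ?D A"
      using A Q by (simp add: emeasure_initial_law)
  qed simp
  then show ?thesis using D[OF g] by simp
qed

lemma nn_integral_step_law:
  assumes N: "sets N = sets (count_space UNIV)" and \<mu>: "prob_space \<mu>" "sets \<mu> = sets borel"
    and g [measurable]: "g \<in> borel_measurable borel"
  shows "(\<integral>\<^sup>+x. g x \<partial>step_law N \<mu>) =
    (\<integral>\<^sup>+k. \<integral>\<^sup>+x. g (max ((\<Sum>i<k. x i) - 1) 0) \<partial>(\<Pi>\<^sub>M i\<in>(UNIV :: nat set). \<mu>) \<partial>N)"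
proof -
  interpret P: prob_space "\<Pi>\<^sub>M i\<in>(UNIV :: nat set). \<mu>"
    using \<mu> by (intro prob_space_PiM) simp
  note [measurable] = measurable_step[OF N \<mu>(2)]
  have "(\<integral>\<^sup>+x. g x \<partial>step_law N \<mu>) = (\<integral>\<^sup>+z. g ((\<lambda>(k, x). max ((\<Sum>i<k. x i) - 1) 0) z)
      \<partial>(N \<Otimes>\<^sub>M (\<Pi>\<^sub>M i\<in>(UNIV :: nat set). \<mu>)))"
    unfolding step_law_def by (intro nn_integral_distr) auto
  also have "\<dots> = (\<integral>\<^sup>+k. \<integral>\<^sup>+x. g ((\<lambda>(k, x). max ((\<Sum>i<k. x i) - 1) 0) (k, x))
      \<partial>(\<Pi>\<^sub>M i\<in>(UNIV :: nat set). \<mu>) \<partial>N)"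
    by (rule P.nn_integral_fst[symmetric]) measurable
  finally show ?thesis by simp
qed

lemma measurable_PiM_coordinate:
  assumes "sets \<mu> = sets borel"
  shows "(\<lambda>x. x i) \<in> (\<Pi>\<^sub>M i\<in>(UNIV :: nat set). \<mu>) \<rightarrow>\<^sub>M (borel :: real measure)"
  using measurable_component_singleton[of i UNIV "\<lambda>_. \<mu>"]
  unfolding measurable_cong_sets[OF refl assms] by blast

lemma nn_integral_PiM_coordinate:
  fixes \<mu> :: "real measure" and g :: "real \<Rightarrow> ennreal"
  assumes \<mu>: "prob_space \<mu>" "sets \<mu> = sets borel"
    and g [measurable]: "g \<in> borel_measurable borel"
  shows "(\<integral>\<^sup>+x. g (x i) \<partial>(\<Pi>\<^sub>M i\<in>(UNIV :: nat set). \<mu>)) = (\<integral>\<^sup>+y. g y \<partial>\<mu>)"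
proof -
  have "(\<integral>\<^sup>+y. g y \<partial>\<mu>) = (\<integral>\<^sup>+y. g y \<partial>distr (\<Pi>\<^sub>M i\<in>(UNIV :: nat set). \<mu>) \<mu> (\<lambda>x. x i))"
    using \<mu> by (subst distr_PiM_component) auto
  also have "\<dots> = (\<integral>\<^sup>+x. g (x i) \<partial>(\<Pi>\<^sub>M i\<in>(UNIV :: nat set). \<mu>))"
    by (rule nn_integral_distr) (use \<mu> in \<open>auto simp: measurable_cong_sets[OF \<mu>(2) refl]\<close>)
  finally show ?thesis by simp
qed

lemma nn_integral_PiM_sum:
  fixes \<mu> :: "real measure" and g :: "real \<Rightarrow> ennreal"
  assumes \<mu>: "prob_space \<mu>" "sets \<mu> = sets borel"
    and g [measurable]: "g \<in> borel_measurable borel"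
  shows "(\<integral>\<^sup>+x. (\<Sum>i<k. g (x i)) \<partial>(\<Pi>\<^sub>M i\<in>(UNIV :: nat set). \<mu>)) = of_nat k * (\<integral>\<^sup>+y. g y \<partial>\<mu>)"
proof -
  note [measurable] = measurable_PiM_coordinate[OF \<mu>(2)]
  show ?thesis
    by (subst nn_integral_sum) (simp_all add: nn_integral_PiM_coordinate[OF \<mu> g])
qed

text \<open>The coordinates are independent under the product measure, hence the integral
  factorises. Independence comes from the criterion that the joint law is the product of the
  marginals, the joint map being the identity here.\<close>

lemma nn_integral_PiM_prod:
  fixes \<mu> :: "real measure" and g :: "real \<Rightarrow> ennreal"
  assumes \<mu>: "prob_space \<mu>" "sets \<mu> = sets borel"
    and g [measurable]: "g \<in> borel_measurable borel"
  shows "(\<integral>\<^sup>+x. (\<Prod>i<k. g (x i)) \<partial>(\<Pi>\<^sub>M i\<in>(UNIV :: nat set). \<mu>)) = (\<integral>\<^sup>+y. g y \<partial>\<mu>) ^ k"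
proof -
  let ?P = "\<Pi>\<^sub>M i\<in>(UNIV :: nat set). \<mu>"
  interpret P: prob_space ?P using \<mu> by (intro prob_space_PiM) simp
  have "P.indep_vars (\<lambda>_. \<mu>) (\<lambda>i x. x i) UNIV"
  proof (subst P.indep_vars_iff_distr_eq_PiM)
    have "distr ?P ?P (\<lambda>x. \<lambda>i\<in>UNIV. x i) = ?P"
      by (simp add: restrict_def distr_id2)
    also have "\<dots> = (\<Pi>\<^sub>M i\<in>UNIV. distr ?P \<mu> (\<lambda>x. x i))"
      using \<mu> by (intro PiM_cong) (simp_all add: distr_PiM_component[of UNIV "\<lambda>_. \<mu>"])
    finally show "distr ?P ?P (\<lambda>x. \<lambda>i\<in>UNIV. x i) = (\<Pi>\<^sub>M i\<in>UNIV. distr ?P \<mu> (\<lambda>x. x i))" .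
  qed auto
  then have "P.indep_vars (\<lambda>_. \<mu>) (\<lambda>i x. x i) {..<k}"
    by (rule P.indep_vars_subset) simp
  then have "P.indep_vars (\<lambda>_. borel) (\<lambda>i x. g (x i)) {..<k}"
    by (rule P.indep_vars_compose2) (simp add: measurable_cong_sets[OF \<mu>(2) refl])
  then show ?thesis
    by (subst P.indep_vars_nn_integral) (simp_all add: nn_integral_PiM_coordinate[OF \<mu> g])
qed

lemma AE_PiM_nonneg:
  assumes "prob_space \<mu>" "AE x in \<mu>. (0 :: real) \<le> x"
  shows "AE x in \<Pi>\<^sub>M i\<in>(UNIV :: nat set). \<mu>. \<forall>i. 0 \<le> x i"
  unfolding AE_all_countable
proof
  fix i
  show "AE x in \<Pi>\<^sub>M i\<in>(UNIV :: nat set). \<mu>. 0 \<le> x i"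
    by (rule AE_PiM_component[where P = "\<lambda>y. 0 \<le> y"]) (use assms in auto)
qed

section \<open>The test function behind the upper bound\<close>

section \<open>A submultiplicative truncated exponential\<close>

text \<open>Exponential of slope \<open>s\<close> up to \<open>L\<close>, continued by its tangent line.\<close>

definition cut_exp :: "real \<Rightarrow> real \<Rightarrow> real \<Rightarrow> real" where
  "cut_exp s L x = exp (s * min x L) * (1 + s * max (x - L) 0)"

lemma borel_measurable_cut_exp [measurable]: "cut_exp s L \<in> borel_measurable borel"
  unfolding cut_exp_def by measurable

lemma cut_exp_0 [simp]: "0 \<le> L \<Longrightarrow> cut_exp s L 0 = 1"
  by (simp add: cut_exp_def)

lemma cut_exp_ge_1:
  assumes "0 \<le> s" "0 \<le> L" "0 \<le> x"
  shows "1 \<le> cut_exp s L x"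
proof -
  have "1 * 1 \<le> exp (s * min x L) * (1 + s * max (x - L) 0)"
    using assms by (intro mult_mono) auto
  then show ?thesis by (simp add: cut_exp_def)
qed

text \<open>The truncation level moves together with the argument, so the \<open>- 1\<close> of the
  recursion costs exactly a factor \<open>exp (- s)\<close>. This is why the level drops by one per
  generation.\<close>

lemma cut_exp_shift: "cut_exp s (L - 1) (x - 1) = exp (- s) * cut_exp s L x"
proof -
  have "s * min (x - 1) (L - 1) = - s + s * min x L"
    by (simp add: min_def algebra_simps)
  then show ?thesis by (simp add: cut_exp_def exp_add[symmetric] mult.assoc[symmetric])
qed

text \<open>Two truncated parts may add up to more than \<open>L\<close>. Their overshoot enters the
  left side through the linear factor and the right side through the exponential one, and
  \<open>1 + u \<le> exp u\<close> favours the latter.\<close>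

lemma cut_exp_add_le:
  assumes "0 \<le> s" "0 \<le> L" "0 \<le> x" "0 \<le> y"
  shows "cut_exp s L (x + y) \<le> cut_exp s L x * cut_exp s L y"
proof -
  let ?a = "min x L" and ?c = "min y L" and ?b = "s * max (x - L) 0" and ?d = "s * max (y - L) 0"
  let ?e = "s * max (?a + ?c - L) 0"
  have nn: "0 \<le> ?b" "0 \<le> ?d" "0 \<le> ?e" using assms by auto
  \<comment> \<open>The excess of \<open>x + y\<close> over \<open>L\<close> splits into the two
    individual excesses and the overshoot of the truncated parts.\<close>
  have "max (x + y - L) 0 = max (x - L) 0 + max (y - L) 0 + max (?a + ?c - L) 0"
    and mn: "min (x + y) L = ?a + ?c - max (?a + ?c - L) 0"
    using assms by (auto simp: min_def max_def)
  then have ex: "s * max (x + y - L) 0 = ?b + ?d + ?e" by (simp add: algebra_simps)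
  have "1 + s * max (x + y - L) 0 \<le> (1 + ?e) * ((1 + ?b) * (1 + ?d))"
  proof -
    have "0 \<le> ?b * ?d + ?e * (?b + ?d + ?b * ?d)" using nn by simp
    then show ?thesis unfolding ex by (simp add: algebra_simps)
  qed
  also have "\<dots> \<le> exp ?e * ((1 + ?b) * (1 + ?d))"
    using nn by (intro mult_right_mono) (auto simp: exp_ge_add_one_self)
  finally have "cut_exp s L (x + y) \<le> exp (s * min (x + y) L) * (exp ?e * ((1 + ?b) * (1 + ?d)))"
    unfolding cut_exp_def by (intro mult_left_mono) auto
  also have "exp (s * min (x + y) L) * exp ?e = exp (s * ?a) * exp (s * ?c)"
    unfolding mn by (simp add: exp_add[symmetric] algebra_simps)
  then have "exp (s * min (x + y) L) * (exp ?e * ((1 + ?b) * (1 + ?d))) =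
      cut_exp s L x * cut_exp s L y"
    by (simp add: cut_exp_def mult.assoc[symmetric])
  finally show ?thesis .
qed

lemma cut_exp_sum_le:
  assumes "0 \<le> s" "0 \<le> L" "\<And>i. 0 \<le> x i"
  shows "cut_exp s L (\<Sum>i<k. x i) \<le> (\<Prod>i<(k :: nat). cut_exp s L (x i))"
proof (induction k)
  case (Suc k)
  have "cut_exp s L (\<Sum>i<Suc k. x i) \<le> cut_exp s L (\<Sum>i<k. x i) * cut_exp s L (x k)"
    using assms by (simp add: cut_exp_add_le sum_nonneg)
  also have "\<dots> \<le> (\<Prod>i<k. cut_exp s L (x i)) * cut_exp s L (x k)"
    using Suc order.trans[OF zero_le_one cut_exp_ge_1[OF assms(1,2) assms(3)]]
    by (intro mult_right_mono) auto
  finally show ?case by simp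
qed (use assms in simp)

text \<open>For a sum of at least 1 this is the shift identity together with
  \<open>exp (- s) \<le> 1\<close>. For a smaller sum the positive part is 0, where
  \<open>cut_exp - 1\<close> vanishes, while the right side is nonnegative.\<close>

lemma cut_exp_step:
  assumes "0 \<le> s" "1 \<le> L" "\<And>i. 0 \<le> x i"
  shows "cut_exp s (L - 1) (max ((\<Sum>i<k. x i) - 1) 0) - 1 \<le>
    exp (- s) * ((\<Prod>i<(k :: nat). cut_exp s L (x i)) - 1)"
proof -
  let ?S = "\<Sum>i<k. x i"
  have S: "0 \<le> ?S" using assms by (simp add: sum_nonneg)
  have le: "cut_exp s L ?S \<le> (\<Prod>i<k. cut_exp s L (x i))"
    using assms by (intro cut_exp_sum_le) auto
  have "cut_exp s (L - 1) (max (?S - 1) 0) - 1 \<le> exp (- s) * (cut_exp s L ?S - 1)"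
  proof (cases "?S \<ge> 1")
    case True
    have "exp (- s) \<le> 1" using assms by simp
    then show ?thesis using True by (simp add: max_absorb1 cut_exp_shift algebra_simps)
  next
    case False
    then show ?thesis using assms S cut_exp_ge_1[of s L ?S] by (simp add: max_absorb2)
  qed
  also have "\<dots> \<le> exp (- s) * ((\<Prod>i<k. cut_exp s L (x i)) - 1)"
    using le by simp
  finally show ?thesis .
qed

text \<open>Trades the slope \<open>s\<close> for a smaller slope \<open>\<theta>\<close> at the
  price \<open>exp ((s - \<theta>) * L)\<close>, so that an exponential moment of order
  \<open>\<theta>\<close> controls the start of the recursion. The factor
  \<open>s / \<theta>\<close> comes from the linear part beyond \<open>L\<close>.\<close>

lemma cut_exp_le:
  assumes "0 < \<theta>" "\<theta> \<le> s" "0 \<le> y"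
  shows "cut_exp s L y \<le> s / \<theta> * exp ((s - \<theta>) * L) * exp (\<theta> * y)"
proof (cases "y \<le> L")
  case True
  have "s * y = (s - \<theta>) * y + \<theta> * y" by (simp add: algebra_simps)
  moreover have "(s - \<theta>) * y \<le> (s - \<theta>) * L" using True assms by (intro mult_left_mono) auto
  ultimately have "exp (s * y) \<le> 1 * (exp ((s - \<theta>) * L) * exp (\<theta> * y))"
    by (simp add: exp_add[symmetric])
  also have "\<dots> \<le> s / \<theta> * (exp ((s - \<theta>) * L) * exp (\<theta> * y))"
    using assms by (intro mult_right_mono) auto
  finally show ?thesis using True by (simp add: cut_exp_def mult_ac)
next
  case False
  have "1 + s * (y - L) \<le> s / \<theta> * (1 + \<theta> * (y - L))"
    using assms False by (simp add: field_simps)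
  also have "\<dots> \<le> s / \<theta> * exp (\<theta> * (y - L))"
    using assms by (intro mult_left_mono) (auto simp: exp_ge_add_one_self)
  finally have "exp (s * L) * (1 + s * (y - L)) \<le> exp (s * L) * (s / \<theta> * exp (\<theta> * (y - L)))"
    by (intro mult_left_mono) auto
  also have "\<dots> = s / \<theta> * exp ((s - \<theta>) * L) * exp (\<theta> * y)"
    by (simp add: mult.assoc exp_add[symmetric] field_simps)
  finally show ?thesis using False by (simp add: cut_exp_def)
qed

section \<open>Slopes of chords through the point at 1, and their limit \<open>m\<close>\<close>

section \<open>The offspring generating function\<close>

text \<open>The slope \<open>(f z - f 1) / (z - 1)\<close> of the generating function \<open>f\<close> of \<open>N\<close>,
  written without a quotient so that its value at \<open>z = 1\<close> is the mean.\<close>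

definition chord_slope :: "nat measure \<Rightarrow> real \<Rightarrow> real" where
  "chord_slope N z = (\<integral>k. (\<Sum>i<k. z ^ i) \<partial>N)"

lemma power_minus_1_eq_sum: "(z :: real) ^ k - 1 = (z - 1) * (\<Sum>i<k. z ^ i)"
  using power_diff_1_eq[of z k] by simp

text \<open>The sum is largest at \<open>z = t\<close>, where it equals
  \<open>(t ^ k - 1) / (t - 1)\<close>, integrable by the exponential moment of the
  offspring.\<close>

lemma integrable_geometric_sum:
  fixes t :: real
  assumes N: "sets N = sets (count_space UNIV)" and t: "1 < t" "integrable N (\<lambda>k. t ^ k)"
    and z: "0 \<le> z" "z \<le> t" and fin: "finite_measure N"
  shows "integrable N (\<lambda>k. \<Sum>i<k. z ^ i)"
proof (rule Bochner_Integration.integrable_bound)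
  interpret finite_measure N by (fact fin)
  show "integrable N (\<lambda>k. (t ^ k - 1) / (t - 1))" using t(2) by simp
  show "(\<lambda>k. \<Sum>i<k. z ^ i) \<in> borel_measurable N"
    by (simp add: measurable_cong_sets[OF N refl])
  show "AE k in N. norm (\<Sum>i<k. z ^ i) \<le> norm ((t ^ k - 1) / (t - 1))"
  proof (rule AE_I2)
    fix k
    have "(t ^ k - 1) / (t - 1) = (\<Sum>i<k. t ^ i)"
      using t by (simp add: power_minus_1_eq_sum)
    moreover have "(\<Sum>i<k. z ^ i) \<le> (\<Sum>i<k. t ^ i)"
      using z by (intro sum_mono power_mono) auto
    ultimately show "norm (\<Sum>i<k. z ^ i) \<le> norm ((t ^ k - 1) / (t - 1))"
      using z by (simp add: sum_nonneg)
  qed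
qed

lemma chord_slope_tendsto:
  fixes t :: real
  assumes N: "sets N = sets (count_space UNIV)" and t: "1 < t" "integrable N (\<lambda>k. t ^ k)"
    and fin: "finite_measure N"
    and z: "\<And>j. 0 \<le> z j" "\<And>j. z j \<le> t" "z \<longlonglongrightarrow> 1"
  shows "(\<lambda>j. chord_slope N (z j)) \<longlonglongrightarrow> (\<integral>k. real k \<partial>N)"
  unfolding chord_slope_def
proof (rule integral_dominated_convergence)
  show "integrable N (\<lambda>k. \<Sum>i<k. t ^ i)"
    using integrable_geometric_sum[OF N t _ _ fin, of t] t by simp
  show "AE k in N. (\<lambda>j. \<Sum>i<k. z j ^ i) \<longlonglongrightarrow> real k"
  proof (rule AE_I2)
    fix k :: nat
    have "(\<lambda>j. \<Sum>i<k. z j ^ i) \<longlonglongrightarrow> (\<Sum>i<k. 1 ^ i)"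
      by (intro tendsto_intros z)
    then show "(\<lambda>j. \<Sum>i<k. z j ^ i) \<longlonglongrightarrow> real k" by simp
  qed
  show "AE k in N. norm (\<Sum>i<k. z j ^ i) \<le> (\<Sum>i<k. t ^ i)" for j
    using z by (intro AE_I2) (auto simp: sum_nonneg intro!: sum_mono power_mono)
qed (simp_all add: measurable_cong_sets[OF N refl])

lemma chord_slope_right:
  fixes t :: real
  assumes N: "sets N = sets (count_space UNIV)" and t: "1 < t" "integrable N (\<lambda>k. t ^ k)"
    and fin: "finite_measure N" and b: "(\<integral>k. real k \<partial>N) < b"
  obtains \<delta> where "0 < \<delta>" "1 + \<delta> \<le> t" "chord_slope N (1 + \<delta>) < b"
proof -
  \<comment> \<open>These points decrease from \<open>t\<close> to 1, so all of them stay in the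
    range covered by the dominating function.\<close>
  let ?z = "\<lambda>j. 1 + (t - 1) * inverse (real (Suc j))"
  have "?z \<longlonglongrightarrow> 1 + (t - 1) * 0"
    by (intro tendsto_intros LIMSEQ_inverse_real_of_nat)
  moreover have z: "0 < ?z j - 1" "?z j \<le> t" for j
  proof -
    have "(t - 1) * inverse (real (Suc j)) \<le> t - 1"
      using t by (intro mult_left_le) (auto simp: field_simps)
    then have "1 + (t - 1) * inverse (real (Suc j)) \<le> 1 + (t - 1)" by (rule add_left_mono)
    then show "?z j \<le> t" by simp
    show "0 < ?z j - 1" using t by simp
  qed
  moreover have "0 \<le> ?z j" for j using z(1)[of j] by linarith
  ultimately have "(\<lambda>j. chord_slope N (?z j)) \<longlonglongrightarrow> (\<integral>k. real k \<partial>N)"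
    by (intro chord_slope_tendsto[OF N t fin]) auto
  then have "\<forall>\<^sub>F j in sequentially. chord_slope N (?z j) < b"
    using b by (rule order_tendstoD)
  then obtain j where "chord_slope N (?z j) < b"
    by (auto simp: eventually_sequentially)
  then show thesis using that[of "?z j - 1"] z[of j] by auto
qed

lemma chord_slope_left:
  fixes t :: real
  assumes N: "sets N = sets (count_space UNIV)" and t: "1 < t" "integrable N (\<lambda>k. t ^ k)"
    and fin: "finite_measure N" and b: "b < (\<integral>k. real k \<partial>N)"
  obtains \<delta> where "0 < \<delta>" "\<delta> \<le> 1" "b < chord_slope N (1 - \<delta>)"
proof -
  let ?z = "\<lambda>j. 1 - inverse (real (Suc j))"
  have "?z \<longlonglongrightarrow> 1 - 0"
    by (intro tendsto_intros LIMSEQ_inverse_real_of_nat)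
  moreover have z: "0 \<le> ?z j" "?z j < 1" for j
    by (auto simp: field_simps)
  moreover have "?z j \<le> t" for j using z(2)[of j] t by linarith
  ultimately have "(\<lambda>j. chord_slope N (?z j)) \<longlonglongrightarrow> (\<integral>k. real k \<partial>N)"
    by (intro chord_slope_tendsto[OF N t fin]) auto
  then have "\<forall>\<^sub>F j in sequentially. b < chord_slope N (?z j)"
    using b by (rule order_tendstoD)
  then obtain j where "b < chord_slope N (?z j)"
    by (auto simp: eventually_sequentially)
  then show thesis using that[of "1 - ?z j"] z[of j] by auto
qed

lemma nn_integral_power_minus_1:
  assumes N: "sets N = sets (count_space UNIV)" and z: "1 \<le> z"
    and int: "integrable N (\<lambda>k. \<Sum>i<k. z ^ i)"
  shows "(\<integral>\<^sup>+k. ennreal (z ^ k - 1) \<partial>N) = ennreal ((z - 1) * chord_slope N z)"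
  unfolding power_minus_1_eq_sum chord_slope_def integral_mult_right_zero[symmetric]
  using int z by (intro nn_integral_eq_integral) (auto simp: sum_nonneg)

text \<open>Convexity of the generating function: the chord slope increases with \<open>z\<close>,
  so on \<open>[1 - \<delta>, 1]\<close> its value at the left endpoint is a lower bound.\<close>

lemma integral_power_le:
  assumes N: "prob_space N" "sets N = sets (count_space UNIV)"
    and z: "0 \<le> z" "z \<le> 1" "\<delta> \<le> 1" "1 - \<delta> \<le> z" and int: "integrable N real"
  shows "(\<integral>k. z ^ k \<partial>N) \<le> 1 - (1 - z) * chord_slope N (1 - \<delta>)"
proof -
  interpret N: prob_space N by (fact N(1))
  have bd: "0 \<le> (\<Sum>i<k. w ^ i) \<and> (\<Sum>i<k. w ^ i) \<le> real k" if "0 \<le> w" "w \<le> 1" for k :: nat and w :: real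
  proof
    have "(\<Sum>i<k. w ^ i) \<le> (\<Sum>i<k. 1)"
      using that by (intro sum_mono) (simp add: power_le_one)
    then show "(\<Sum>i<k. w ^ i) \<le> real k" by simp
  qed (use that in \<open>simp add: sum_nonneg\<close>)
  have int': "integrable N (\<lambda>k. \<Sum>i<k. w ^ i)" if "0 \<le> w" "w \<le> 1" for w :: real
    by (rule Bochner_Integration.integrable_bound[OF int])
      (use bd[OF that] in \<open>auto simp: measurable_cong_sets[OF N(2) refl]\<close>)
  have 1: "z ^ k = 1 - (1 - z) * (\<Sum>i<k. z ^ i)" for k
    using power_minus_1_eq_sum[of z k] by (simp add: algebra_simps)
  have eq: "(\<integral>k. z ^ k \<partial>N) = 1 - (1 - z) * chord_slope N z"
  proof -
    have "(\<integral>k. z ^ k \<partial>N) = (\<integral>k. 1 - (1 - z) * (\<Sum>i<k. z ^ i) \<partial>N)"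
      by (intro Bochner_Integration.integral_cong refl 1)
    then show ?thesis using int'[OF z(1,2)] by (simp add: chord_slope_def N.prob_space)
  qed
  have "chord_slope N (1 - \<delta>) \<le> chord_slope N z"
    unfolding chord_slope_def using z
    by (intro integral_mono int') (auto intro!: sum_mono power_mono)
  then have "1 - (1 - z) * chord_slope N z \<le> 1 - (1 - z) * chord_slope N (1 - \<delta>)"
    using z by (simp add: mult_left_mono)
  then show ?thesis using eq by simp
qed

lemma ennreal_le_diff_one:
  assumes "a + 1 \<le> ennreal c"
  shows "a \<le> ennreal (c - 1)"
proof (cases a)
  case (real r)
  then have "ennreal (r + 1) \<le> ennreal c" using assms by simp
  then have "r + 1 \<le> c" using real by (subst (asm) ennreal_le_iff2) auto
  then show ?thesis using real by (simp add: ennreal_leI)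
next
  case top
  then show ?thesis using assms by (simp add: top_unique)
qed

section \<open>Mean, truncated exponential moment and tail under a single transition\<close>

section \<open>One generation\<close>

text \<open>Means of \<open>\<mu>\<close> are kept in \<open>ennreal\<close>, because their
  finiteness along the recursion is itself derived from the estimates of this locale.\<close>

locale offspring_step =
  fixes N :: "nat measure" and \<mu> :: "real measure"
  assumes prob_N: "prob_space N" and sets_N: "sets N = sets (count_space UNIV)"
    and int_N: "integrable N real"
    and prob_\<mu>: "prob_space \<mu>" and sets_\<mu>: "sets \<mu> = sets borel"
    and nonneg_\<mu>: "AE x in \<mu>. 0 \<le> x"
begin

abbreviation P where "P \<equiv> \<Pi>\<^sub>M i\<in>(UNIV :: nat set). \<mu>"

lemma AE_P: "AE x in P. \<forall>i. 0 \<le> x i"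
  using prob_\<mu> nonneg_\<mu> by (rule AE_PiM_nonneg)

lemmas [measurable] = measurable_PiM_coordinate[OF sets_\<mu>]
lemmas [measurable_cong] = sets_\<mu> sets_N

lemma emeasure_P: "emeasure P (space P) = 1"
  using prob_\<mu> by (intro prob_space.emeasure_space_1 prob_space_PiM) simp

lemma nn_integral_nu: "(\<integral>\<^sup>+k. of_nat k \<partial>N) = ennreal (\<integral>k. real k \<partial>N)"
proof -
  have "(\<integral>\<^sup>+k. of_nat k \<partial>N) = (\<integral>\<^sup>+k. ennreal (real k) \<partial>N)"
    by (simp add: ennreal_of_nat_eq_real_of_nat)
  then show ?thesis using int_N by (simp add: nn_integral_eq_integral)
qed

lemma nn_integral_sum_P:
  "(\<integral>\<^sup>+x. ennreal (\<Sum>i<k. x i) \<partial>P) = of_nat k * (\<integral>\<^sup>+x. ennreal x \<partial>\<mu>)"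
proof -
  have "(\<integral>\<^sup>+x. ennreal (\<Sum>i<k. x i) \<partial>P) = (\<integral>\<^sup>+x. (\<Sum>i<k. ennreal (x i)) \<partial>P)"
    using AE_P by (intro nn_integral_cong_AE) (auto elim!: eventually_mono)
  then show ?thesis
    using nn_integral_PiM_sum[OF prob_\<mu> sets_\<mu>, of ennreal k] by simp
qed

lemma nn_integral_sum_total:
  "(\<integral>\<^sup>+k. \<integral>\<^sup>+x. ennreal (\<Sum>i<k. x i) \<partial>P \<partial>N) = ennreal (\<integral>k. real k \<partial>N) * (\<integral>\<^sup>+x. ennreal x \<partial>\<mu>)"
  unfolding nn_integral_sum_P nn_integral_nu[symmetric]
  by (rule nn_integral_multc) (simp add: measurable_cong_sets[OF sets_N refl])

lemma nn_integral_step: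
  assumes "g \<in> borel_measurable borel"
  shows "(\<integral>\<^sup>+x. g x \<partial>step_law N \<mu>) = (\<integral>\<^sup>+k. \<integral>\<^sup>+x. g (max ((\<Sum>i<k. x i) - 1) 0) \<partial>P \<partial>N)"
  using nn_integral_step_law[OF sets_N prob_\<mu> sets_\<mu> assms] .

lemma mean_step_le:
  "(\<integral>\<^sup>+x. ennreal x \<partial>step_law N \<mu>) \<le> ennreal (\<integral>k. real k \<partial>N) * (\<integral>\<^sup>+x. ennreal x \<partial>\<mu>)"
  unfolding nn_integral_sum_total[symmetric] nn_integral_step[OF measurable_ennreal]
proof (rule nn_integral_mono, rule nn_integral_mono_AE)
  fix k show "AE x in P. ennreal (max ((\<Sum>i<k. x i) - 1) 0) \<le> ennreal (\<Sum>i<k. x i)"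
    using AE_P by eventually_elim (simp add: ennreal_leI sum_nonneg)
qed

text \<open>Integrates \<open>S \<le> max (S - 1) 0 + 1\<close>; the 1 stands on the right to avoid
  the truncated subtraction of \<open>ennreal\<close>.\<close>

lemma mean_step_ge:
  "ennreal (\<integral>k. real k \<partial>N) * (\<integral>\<^sup>+x. ennreal x \<partial>\<mu>) \<le> (\<integral>\<^sup>+x. ennreal x \<partial>step_law N \<mu>) + 1"
proof -
  interpret N: prob_space N by (fact prob_N)
  have "(\<integral>\<^sup>+x. ennreal (\<Sum>i<k. x i) \<partial>P) \<le> (\<integral>\<^sup>+x. ennreal (max ((\<Sum>i<k. x i) - 1) 0) \<partial>P) + 1" for k
  proof -
    have "(\<integral>\<^sup>+x. ennreal (\<Sum>i<k. x i) \<partial>P) \<le> (\<integral>\<^sup>+x. ennreal (max ((\<Sum>i<k. x i) - 1) 0) + 1 \<partial>P)"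
    proof (rule nn_integral_mono)
      fix x :: "nat \<Rightarrow> real"
      have "ennreal (\<Sum>i<k. x i) \<le> ennreal (max ((\<Sum>i<k. x i) - 1) 0 + 1)"
        by (intro ennreal_leI) linarith
      then show "ennreal (\<Sum>i<k. x i) \<le> ennreal (max ((\<Sum>i<k. x i) - 1) 0) + 1"
        by (simp add: ennreal_plus)
    qed
    then show ?thesis by (simp add: nn_integral_add emeasure_P)
  qed
  then have "(\<integral>\<^sup>+k. \<integral>\<^sup>+x. ennreal (\<Sum>i<k. x i) \<partial>P \<partial>N) \<le>
      (\<integral>\<^sup>+k. (\<integral>\<^sup>+x. ennreal (max ((\<Sum>i<k. x i) - 1) 0) \<partial>P) + 1 \<partial>N)"
    by (intro nn_integral_mono)
  also have "\<dots> = (\<integral>\<^sup>+x. ennreal x \<partial>step_law N \<mu>) + 1"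
    unfolding nn_integral_step[OF measurable_ennreal]
    by (subst nn_integral_add) (simp_all add: N.emeasure_space_1 measurable_cong_sets[OF sets_N refl])
  finally show ?thesis by (simp add: nn_integral_sum_total)
qed

text \<open>The bound \<open>\<delta>\<close> reproduces itself: submultiplicativity and
  independence give \<open>(1 + \<delta>) ^ k - 1\<close> for \<open>k\<close> children, averaging
  over \<open>k\<close> gives \<open>\<delta>\<close> times the chord slope, and the factor
  \<open>exp (- s)\<close> from the shift cancels that slope.\<close>

lemma cut_exp_mean_step:
  assumes s: "0 \<le> s" "1 \<le> L" and \<delta>: "0 \<le> \<delta>" "chord_slope N (1 + \<delta>) \<le> exp s"
    and int: "integrable N (\<lambda>k. \<Sum>i<k. (1 + \<delta>) ^ i)"
    and le: "(\<integral>\<^sup>+x. ennreal (cut_exp s L x - 1) \<partial>\<mu>) \<le> ennreal \<delta>"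
  shows "(\<integral>\<^sup>+x. ennreal (cut_exp s (L - 1) x - 1) \<partial>step_law N \<mu>) \<le> ennreal \<delta>"
proof -
  interpret \<mu>: prob_space \<mu> by (fact prob_\<mu>)
  let ?\<phi> = "cut_exp s L"
  have \<phi>1: "1 \<le> ?\<phi> x" if "0 \<le> x" for x using s that by (intro cut_exp_ge_1) auto
  have "(\<integral>\<^sup>+x. ennreal (?\<phi> x) \<partial>\<mu>) = (\<integral>\<^sup>+x. ennreal (?\<phi> x - 1) + 1 \<partial>\<mu>)"
  proof (rule nn_integral_cong_AE)
    show "AE x in \<mu>. ennreal (?\<phi> x) = ennreal (?\<phi> x - 1) + 1"
      using nonneg_\<mu>
    proof eventually_elim
      case (elim x)
      then show ?case using \<phi>1[of x] by (simp add: ennreal_plus[symmetric] flip: ennreal_1)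
    qed
  qed
  also have "\<dots> \<le> ennreal \<delta> + 1"
    using le by (subst nn_integral_add) (auto simp: \<mu>.emeasure_space_1 measurable_cong_sets[OF sets_\<mu> refl])
  finally have \<phi>_le: "(\<integral>\<^sup>+x. ennreal (?\<phi> x) \<partial>\<mu>) \<le> ennreal (1 + \<delta>)"
    using \<delta> by (simp add: add.commute)
  have "(\<integral>\<^sup>+x. ennreal (cut_exp s (L - 1) (max ((\<Sum>i<k. x i) - 1) 0) - 1) \<partial>P) \<le>
      ennreal (exp (- s)) * ennreal ((1 + \<delta>) ^ k - 1)" for k
  proof -
    let ?\<Pi> = "\<lambda>x :: nat \<Rightarrow> real. \<Prod>i<k. ?\<phi> (x i)"
    \<comment> \<open>Adding 1 restores the pure product, whose integral factorises; the 1 is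
      cancelled again at the end.\<close>
    have "(\<integral>\<^sup>+x. ennreal (?\<Pi> x - 1) \<partial>P) + 1 = (\<integral>\<^sup>+x. ennreal (?\<Pi> x - 1) + 1 \<partial>P)"
      by (subst nn_integral_add) (simp_all add: emeasure_P)
    also have "\<dots> = (\<integral>\<^sup>+x. (\<Prod>i<k. ennreal (?\<phi> (x i))) \<partial>P)"
    proof (rule nn_integral_cong_AE)
      show "AE x in P. ennreal (?\<Pi> x - 1) + 1 = (\<Prod>i<k. ennreal (?\<phi> (x i)))"
        using AE_P
      proof eventually_elim
        case (elim x)
        then have 1: "1 \<le> ?\<phi> (x i)" for i using \<phi>1 by simp
        then have "1 \<le> ?\<Pi> x" by (intro prod_ge_1)
        moreover have "(\<Prod>i<k. ennreal (?\<phi> (x i))) = ennreal (?\<Pi> x)"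
          using order.trans[OF zero_le_one 1] by (intro prod_ennreal) auto
        ultimately show ?case by (simp add: ennreal_plus[symmetric] flip: ennreal_1)
      qed
    qed
    also have "\<dots> = (\<integral>\<^sup>+x. ennreal (?\<phi> x) \<partial>\<mu>) ^ k"
      by (rule nn_integral_PiM_prod[OF prob_\<mu> sets_\<mu>]) simp
    also have "\<dots> \<le> ennreal (1 + \<delta>) ^ k"
      using \<phi>_le by (intro power_mono) auto
    also have "\<dots> = ennreal ((1 + \<delta>) ^ k)"
      using \<delta> by (intro ennreal_power) simp
    finally have \<Pi>: "(\<integral>\<^sup>+x. ennreal (?\<Pi> x - 1) \<partial>P) \<le> ennreal ((1 + \<delta>) ^ k - 1)"
      by (rule ennreal_le_diff_one)
    have "(\<integral>\<^sup>+x. ennreal (cut_exp s (L - 1) (max ((\<Sum>i<k. x i) - 1) 0) - 1) \<partial>P) \<le>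
        (\<integral>\<^sup>+x. ennreal (exp (- s)) * ennreal (?\<Pi> x - 1) \<partial>P)"
    proof (rule nn_integral_mono_AE)
      show "AE x in P. ennreal (cut_exp s (L - 1) (max ((\<Sum>i<k. x i) - 1) 0) - 1) \<le>
          ennreal (exp (- s)) * ennreal (?\<Pi> x - 1)"
        using AE_P
      proof eventually_elim
        case (elim x)
        have "ennreal (cut_exp s (L - 1) (max ((\<Sum>i<k. x i) - 1) 0) - 1) \<le>
            ennreal (exp (- s) * (?\<Pi> x - 1))"
          using cut_exp_step[of s L x k] s elim by (intro ennreal_leI) auto
        then show ?case by (simp add: ennreal_mult')
      qed
    qed
    also have "\<dots> = ennreal (exp (- s)) * (\<integral>\<^sup>+x. ennreal (?\<Pi> x - 1) \<partial>P)"
      by (rule nn_integral_cmult) simp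
    also have "\<dots> \<le> ennreal (exp (- s)) * ennreal ((1 + \<delta>) ^ k - 1)"
      using \<Pi> by (intro mult_left_mono) auto
    finally show ?thesis .
  qed
  then have "(\<integral>\<^sup>+x. ennreal (cut_exp s (L - 1) x - 1) \<partial>step_law N \<mu>) \<le>
      (\<integral>\<^sup>+k. ennreal (exp (- s)) * ennreal ((1 + \<delta>) ^ k - 1) \<partial>N)"
    by (subst nn_integral_step) (auto intro!: nn_integral_mono)
  also have "\<dots> = ennreal (exp (- s)) * (\<integral>\<^sup>+k. ennreal ((1 + \<delta>) ^ k - 1) \<partial>N)"
    by (rule nn_integral_cmult) (simp add: measurable_cong_sets[OF sets_N refl])
  also have "\<dots> = ennreal (exp (- s) * (\<delta> * chord_slope N (1 + \<delta>)))"
    using \<delta> int by (simp add: nn_integral_power_minus_1[OF sets_N] ennreal_mult')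
  also have "\<dots> \<le> ennreal \<delta>"
  proof (rule ennreal_leI)
    have "exp (- s) * (\<delta> * chord_slope N (1 + \<delta>)) \<le> exp (- s) * (\<delta> * exp s)"
      using \<delta> by (intro mult_left_mono) auto
    also have "\<dots> = \<delta>" by (simp add: exp_minus)
    finally show "exp (- s) * (\<delta> * chord_slope N (1 + \<delta>)) \<le> \<delta>" .
  qed
  finally show ?thesis .
qed

text \<open>One child of size at least \<open>c + 1\<close> already pushes the parent to
  \<open>c\<close>. Hence a parent below \<open>c\<close> has all its children below
  \<open>c + 1\<close>, an event of probability at most the generating function at
  \<open>1 - a\<close>, which convexity bounds linearly in \<open>a\<close>.\<close>

lemma tail_step:
  assumes c: "0 < c" and \<delta>: "\<delta> \<le> 1" and a: "0 \<le> a" "a \<le> \<delta>" "a \<le> measure \<mu> {c + 1..}"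
  shows "a * chord_slope N (1 - \<delta>) \<le> measure (step_law N \<mu>) {c..}"
proof -
  interpret \<mu>: prob_space \<mu> by (fact prob_\<mu>)
  have sp: "space \<mu> = UNIV" using sets_eq_imp_space_eq[OF sets_\<mu>] by simp
  have "prob_space P" using prob_\<mu> by (intro prob_space_PiM) simp
  then have "prob_space (N \<Otimes>\<^sub>M P)" using prob_N by (rule prob_space_pair[rotated])
  then interpret S: prob_space "step_law N \<mu>"
    unfolding step_law_def using measurable_step[OF sets_N sets_\<mu>]
    by (rule prob_space.prob_space_distr)
  have S_sets: "sets (step_law N \<mu>) = sets borel" "space (step_law N \<mu>) = UNIV"
    by (simp_all add: step_law_def)
  have "measure \<mu> {..<c + 1} = 1 - measure \<mu> {c + 1..}"
    using \<mu>.prob_compl[of "{c + 1..}"] sp sets_\<mu> by (simp add: Compl_eq_Diff_UNIV[symmetric])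
  then have \<mu>_le: "emeasure \<mu> {..<c + 1} \<le> ennreal (1 - a)"
    using a by (simp add: \<mu>.emeasure_eq_measure ennreal_leI)
  have "(\<integral>\<^sup>+x. indicator {..<c} (max ((\<Sum>i<k. x i) - 1) 0) \<partial>P) \<le> ennreal ((1 - a) ^ k)" for k
  proof -
    have "(\<integral>\<^sup>+x. indicator {..<c} (max ((\<Sum>i<k. x i) - 1) 0) \<partial>P) \<le>
        (\<integral>\<^sup>+x. (\<Prod>i<k. indicator {..<c + 1} (x i)) \<partial>P)"
    proof (rule nn_integral_mono_AE)
      show "AE x in P. (indicator {..<c} (max ((\<Sum>i<k. x i) - 1) 0) :: ennreal) \<le>
          (\<Prod>i<k. indicator {..<c + 1} (x i))"
        using AE_P
      proof eventually_elim
        case (elim x)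
        \<comment> \<open>A single term is at most the whole sum, the coordinates being
          nonnegative.\<close>
        have "x i < c + 1" if "i < k" "max ((\<Sum>i<k. x i) - 1) 0 < c" for i
          using that elim member_le_sum[of i "{..<k}" x] by auto
        then show ?case by (auto simp: indicator_def split: if_splits)
      qed
    qed
    also have "\<dots> = emeasure \<mu> {..<c + 1} ^ k"
      using nn_integral_PiM_prod[OF prob_\<mu> sets_\<mu>, of "indicator {..<c + 1}"]
      by (simp add: sets_\<mu>)
    also have "\<dots> \<le> ennreal (1 - a) ^ k" using \<mu>_le by (intro power_mono) auto
    also have "\<dots> = ennreal ((1 - a) ^ k)" using a \<delta> by (intro ennreal_power) simp
    finally show ?thesis .
  qed
  then have "emeasure (step_law N \<mu>) {..<c} \<le> (\<integral>\<^sup>+k. ennreal ((1 - a) ^ k) \<partial>N)"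
    using nn_integral_step[of "indicator {..<c}"]
    by (auto simp: S_sets intro!: nn_integral_mono)
  also have "\<dots> = ennreal (\<integral>k. (1 - a) ^ k \<partial>N)"
  proof (rule nn_integral_eq_integral)
    interpret N: prob_space N by (fact prob_N)
    show "integrable N (\<lambda>k. (1 - a) ^ k)"
      by (rule N.integrable_const_bound[of _ 1])
        (use a \<delta> in \<open>auto simp: power_le_one measurable_cong_sets[OF sets_N refl]\<close>)
  qed (use a \<delta> in simp)
  finally have "measure (step_law N \<mu>) {..<c} \<le> (\<integral>k. (1 - a) ^ k \<partial>N)"
    using a \<delta> by (subst (asm) S.emeasure_eq_measure) (simp add: integral_nonneg)
  also have "\<dots> \<le> 1 - (1 - (1 - a)) * chord_slope N (1 - \<delta>)"
    using a \<delta> by (intro integral_power_le prob_N sets_N int_N) auto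
  finally have "measure (step_law N \<mu>) {..<c} \<le> 1 - a * chord_slope N (1 - \<delta>)" by simp
  moreover have "measure (step_law N \<mu>) {..<c} = 1 - measure (step_law N \<mu>) {c..}"
    using S.prob_compl[of "{c..}"] S_sets by (simp add: Compl_eq_Diff_UNIV[symmetric])
  ultimately show ?thesis by simp
qed

end

section \<open>Two-sided control of the limit by finite generations\<close>

section \<open>Bounds for the free energy\<close>

locale derrida_retaux =
  fixes N :: "nat measure" and Q :: "real measure" and t m :: real
  assumes prob_N: "prob_space N" and sets_N: "sets N = sets (count_space UNIV)"
    and t: "1 < t" "integrable N (\<lambda>k. t ^ k)"
    and m_eq: "m = (\<integral>k. real k \<partial>N)" and m: "1 < m"
    and prob_Q: "prob_space Q" and sets_Q: "sets Q = sets borel"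
    and nonneg_Q: "AE y in Q. 0 \<le> y"
    and finite_mean_Q: "(\<integral>\<^sup>+y. ennreal y \<partial>Q) < \<infinity>"
begin

lemma finite_measure_N: "finite_measure N"
  using prob_N by (rule prob_space.finite_measure)

lemma integrable_geometric_sum_N: "0 \<le> z \<Longrightarrow> z \<le> t \<Longrightarrow> integrable N (\<lambda>k. \<Sum>i<k. z ^ i)"
  using integrable_geometric_sum[OF sets_N t _ _ finite_measure_N] .

lemma integrable_N: "integrable N real"
  using integrable_geometric_sum_N[of 1] t by simp

context
  fixes p :: real
  assumes p: "0 \<le> p" "p \<le> 1"
begin

abbreviation law where "law \<equiv> law_X N Q p"

lemma prob_space_law: "prob_space (law n)" and sets_law: "sets (law n) = sets borel"
  using prob_space_law_X[OF prob_N sets_N prob_Q sets_Q p] by auto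

lemma AE_law_nonneg: "AE x in law n. 0 \<le> x"
proof (cases n)
  case 0
  have "emeasure Q {..<0} = 0"
    using nonneg_Q AE_iff_measurable[of "{..<0}" Q "\<lambda>y. 0 \<le> y"] sets_Q
    by (auto simp: sets_eq_imp_space_eq[OF sets_Q] not_le)
  then have "emeasure (initial_law p Q) {..<0} = 0"
    using sets_Q by (simp add: emeasure_initial_law)
  then show ?thesis
    unfolding 0 law_X.simps by (intro AE_I[where N = "{..<0}"]) (auto simp: not_le)
next
  case (Suc k)
  have "AE x in step_law N (law k). 0 \<le> x"
    unfolding step_law_def
    by (subst AE_distr_iff[OF measurable_step[OF sets_N sets_law]]) auto
  then show ?thesis unfolding Suc law_X.simps .
qed

lemma offspring_step_law: "offspring_step N (law n)"
  using prob_N sets_N integrable_N prob_space_law sets_law AE_law_nonneg by (intro offspring_step.intro)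

definition mean :: "nat \<Rightarrow> real" where
  "mean n = (\<integral>x. x \<partial>law n)"

text \<open>The Bochner integral in \<open>mean\<close> would default to 0 on a non-integrable
  variable; finiteness is what identifies it with the nonnegative integral.\<close>

lemma nn_mean_finite: "(\<integral>\<^sup>+x. ennreal x \<partial>law n) < \<infinity>"
proof (induction n)
  case 0
  show ?case
    using nn_integral_initial_law[OF prob_Q sets_Q p measurable_ennreal] finite_mean_Q
    by (simp add: ennreal_mult_less_top)
next
  case (Suc n)
  interpret offspring_step N "law n" by (rule offspring_step_law)
  show ?case
    using mean_step_le Suc by (auto simp: ennreal_mult_less_top intro: le_less_trans)
qed

lemma nn_mean: "(\<integral>\<^sup>+x. ennreal x \<partial>law n) = ennreal (mean n)"
proof -
  have "mean n = enn2real (\<integral>\<^sup>+x. ennreal x \<partial>law n)"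
    unfolding mean_def using AE_law_nonneg
    by (intro integral_eq_nn_integral) (simp_all add: measurable_cong_sets[OF sets_law refl])
  then show ?thesis using nn_mean_finite[of n] by simp
qed

lemma mean_nonneg: "0 \<le> mean n"
  unfolding mean_def using AE_law_nonneg by (rule integral_nonneg_AE)

lemma mean_Suc_le: "mean (Suc n) \<le> m * mean n"
proof -
  interpret offspring_step N "law n" by (rule offspring_step_law)
  have "ennreal (mean (Suc n)) \<le> ennreal (m * mean n)"
    using mean_step_le nn_mean[of "Suc n"] nn_mean[of n] mean_nonneg m by (simp add: m_eq ennreal_mult)
  then show ?thesis using mean_nonneg[of n] m by (simp add: ennreal_le_iff)
qed

lemma mean_Suc_ge: "m * mean n - 1 \<le> mean (Suc n)"
proof -
  interpret offspring_step N "law n" by (rule offspring_step_law)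
  have "ennreal (m * mean n) \<le> ennreal (mean (Suc n)) + 1"
    using mean_step_ge nn_mean[of "Suc n"] nn_mean[of n] mean_nonneg m
    by (simp add: m_eq ennreal_mult)
  also have "\<dots> = ennreal (mean (Suc n) + 1)"
    using mean_nonneg[of "Suc n"] by simp
  finally have "m * mean n \<le> mean (Suc n) + 1"
    using mean_nonneg[of "Suc n"] by (subst (asm) ennreal_le_iff) auto
  then show ?thesis by simp
qed

lemma decseq_mean: "decseq (\<lambda>n. mean n / m ^ n)"
  using mean_Suc_le m by (intro decseq_SucI) (simp add: field_simps)

text \<open>\<open>free_energy\<close> is a \<open>lim\<close>, which is informative only after
  convergence is known; here the sequence decreases and is bounded below by 0.\<close>

lemma mean_tendsto: "(\<lambda>n. mean n / m ^ n) \<longlonglongrightarrow> free_energy N Q p"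
proof -
  have "convergent (\<lambda>n. mean n / m ^ n)"
    using decseq_mean mean_nonneg m
    by (intro Bseq_monoseq_convergent decseq_imp_monoseq decseq_bounded[where B = 0]) auto
  then show ?thesis
    by (simp add: free_energy_def mean_def m_eq[symmetric] convergent_LIMSEQ_iff)
qed

lemma free_energy_le_mean: "free_energy N Q p \<le> mean n / m ^ n"
  using decseq_mean mean_tendsto by (rule decseq_ge)

text \<open>The number \<open>1 / (m - 1)\<close> is the fixed point of the map sending
  \<open>x\<close> to \<open>m * x - 1\<close>, the worst case of \<open>mean_Suc_ge\<close>.
  Centred there, the normalised means increase, and the centring disappears in the limit.\<close>

lemma mean_le_free_energy: "(mean n - 1 / (m - 1)) / m ^ n \<le> free_energy N Q p"
proof -
  let ?a = "\<lambda>n. (mean n - 1 / (m - 1)) / m ^ n"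
  have "incseq ?a"
  proof (rule incseq_SucI)
    fix n
    have "m * (mean n - 1 / (m - 1)) \<le> mean (Suc n) - 1 / (m - 1)"
    proof -
      have "m * (1 / (m - 1)) = 1 + 1 / (m - 1)" using m by (simp add: field_simps)
      then show ?thesis using mean_Suc_ge[of n] by (simp add: right_diff_distrib)
    qed
    then have "m * (mean n - 1 / (m - 1)) / m ^ Suc n \<le> (mean (Suc n) - 1 / (m - 1)) / m ^ Suc n"
      using m by (intro divide_right_mono) auto
    then show "?a n \<le> ?a (Suc n)" using m by simp
  qed
  moreover have "?a \<longlonglongrightarrow> free_energy N Q p - 0"
  proof -
    have "(\<lambda>n. 1 / (m - 1) * (1 / m) ^ n) \<longlonglongrightarrow> 1 / (m - 1) * 0"
      using m by (intro tendsto_mult_left LIMSEQ_realpow_zero) auto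
    then have "(\<lambda>n. mean n / m ^ n - 1 / (m - 1) * (1 / m) ^ n) \<longlonglongrightarrow> free_energy N Q p - 0"
      using mean_tendsto by (intro tendsto_diff) auto
    then show ?thesis by (simp add: diff_divide_distrib power_one_over)
  qed
  ultimately show ?thesis using incseq_le[of ?a] by simp
qed

text \<open>The bound \<open>\<delta>\<close> is carried through \<open>L\<close> generations while
  the truncation level falls from \<open>L\<close> to 0. At level 0 the test function minus 1 is
  \<open>s * x\<close>, so the bound becomes one on the mean of generation \<open>L\<close>.\<close>

lemma free_energy_upper:
  assumes s: "0 < s" and \<delta>: "0 < \<delta>" "1 + \<delta> \<le> t" "chord_slope N (1 + \<delta>) \<le> exp s"
    and le: "ennreal p * (\<integral>\<^sup>+y. ennreal (cut_exp s (real L) y - 1) \<partial>Q) \<le> ennreal \<delta>"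
  shows "free_energy N Q p \<le> \<delta> / s / m ^ L"
proof -
  have "(\<integral>\<^sup>+x. ennreal (cut_exp s (real L - real n) x - 1) \<partial>law n) \<le> ennreal \<delta>" if "n \<le> L" for n
    using that
  proof (induction n)
    case 0
    show ?case
      using nn_integral_initial_law[OF prob_Q sets_Q p, of "\<lambda>x. ennreal (cut_exp s (real L) x - 1)"] le
      by simp
  next
    case (Suc n)
    interpret offspring_step N "law n" by (rule offspring_step_law)
    have "real L - real (Suc n) = real L - real n - 1" by simp
    then show ?case
      unfolding law_X.simps using Suc s \<delta>
      by (simp only:) (intro cut_exp_mean_step integrable_geometric_sum_N, auto)
  qed
  from this[of L] have "(\<integral>\<^sup>+x. ennreal (cut_exp s 0 x - 1) \<partial>law L) \<le> ennreal \<delta>" by simp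
  also have "(\<integral>\<^sup>+x. ennreal (cut_exp s 0 x - 1) \<partial>law L) = (\<integral>\<^sup>+x. ennreal s * ennreal x \<partial>law L)"
  proof (rule nn_integral_cong_AE)
    show "AE x in law L. ennreal (cut_exp s 0 x - 1) = ennreal s * ennreal x"
      using AE_law_nonneg by eventually_elim (use s in \<open>simp add: cut_exp_def ennreal_mult\<close>)
  qed
  also have "\<dots> = ennreal (s * mean L)"
    using s mean_nonneg
    by (subst nn_integral_cmult)
      (simp_all add: nn_mean ennreal_mult measurable_cong_sets[OF sets_law refl])
  finally have "mean L \<le> \<delta> / s"
    using s \<delta> by (simp add: ennreal_le_iff field_simps)
  then have "mean L / m ^ L \<le> \<delta> / s / m ^ L"
    using m by (intro divide_right_mono) auto
  then show ?thesis using free_energy_le_mean[of L] by linarith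
qed

text \<open>The tail probability grows by a factor \<open>b\<close> per generation up to the cap
  \<open>\<delta>\<close>, while its threshold falls from \<open>K + n\<close> to \<open>K\<close>.
  Markov's inequality then gives a mean of at least \<open>\<delta> * K\<close>, twice the offset
  \<open>1 / (m - 1)\<close>, so half of it survives the centring.\<close>

lemma free_energy_lower:
  assumes \<delta>: "0 < \<delta>" "\<delta> \<le> 1" "b \<le> chord_slope N (1 - \<delta>)" and b: "1 \<le> b"
    and K: "0 < K" "2 / (m - 1) \<le> \<delta> * K"
    and n: "\<delta> \<le> b ^ n * (p * measure Q {K + real n..})"
  shows "1 / (m - 1) / m ^ n \<le> free_energy N Q p"
proof -
  interpret Q: prob_space Q by (rule prob_Q)
  define q where "q = p * measure Q {K + real n..}"
  have q: "0 \<le> q" using p by (simp add: q_def)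
  \<comment> \<open>The cap keeps the probability in the range where the chord slope at
    \<open>1 - \<delta>\<close> is a valid growth factor.\<close>
  have claim: "min \<delta> (b ^ j * q) \<le> measure (law j) {K + real n - real j..}" if "j \<le> n" for j
    using that
  proof (induction j)
    case 0
    interpret L: prob_space "law 0" by (rule prob_space_law)
    let ?A = "{K + real n..}"
    have "ennreal q \<le> emeasure (law 0) ?A"
      using p sets_Q by (simp add: q_def emeasure_initial_law ennreal_mult Q.emeasure_eq_measure)
    then have "q \<le> measure (law 0) ?A"
      by (simp add: L.emeasure_eq_measure ennreal_le_iff del: law_X.simps)
    then show ?case by simp
  next
    case (Suc j)
    interpret offspring_step N "law j" by (rule offspring_step_law)
    let ?a = "min \<delta> (b ^ j * q)" and ?c = "K + real n - real (Suc j)"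
    have a: "0 \<le> ?a" using \<delta> b q by simp
    have c: "0 < ?c" "?c + 1 = K + real n - real j" using K Suc by auto
    \<comment> \<open>Once the cap is reached, \<open>b \<ge> 1\<close> prevents falling below it
      again.\<close>
    have "min \<delta> (b ^ Suc j * q) \<le> ?a * b"
    proof (cases "\<delta> \<le> b ^ j * q")
      case True
      have "\<delta> * 1 \<le> \<delta> * b" using \<delta> b by (intro mult_left_mono) auto
      then show ?thesis using True by (auto simp: min_def)
    qed (simp add: min_def mult_ac)
    also have "\<dots> \<le> ?a * chord_slope N (1 - \<delta>)"
      using a \<delta> by (intro mult_left_mono)
    also have "\<dots> \<le> measure (step_law N (law j)) {?c..}"
    proof (rule tail_step)
      show "?a \<le> measure (law j) {?c + 1..}" unfolding c(2) using Suc by simp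
    qed (use a c(1) \<delta> in auto)
    finally show ?case by simp
  qed
  interpret L: prob_space "law n" by (rule prob_space_law)
  have "\<delta> \<le> measure (law n) {K..}"
    using claim[of n] n by (simp add: q_def)
  then have "\<delta> * K \<le> K * measure (law n) {K..}"
    using K by (subst mult.commute) (intro mult_left_mono, auto)
  with K(2) have "2 / (m - 1) \<le> K * measure (law n) {K..}" by (rule order.trans)
  also have "\<dots> \<le> mean n"
  proof -
    have "ennreal (K * measure (law n) {K..}) = ennreal K * emeasure (law n) {K..}"
      using K by (simp add: ennreal_mult L.emeasure_eq_measure)
    also have "\<dots> = (\<integral>\<^sup>+x. ennreal K * indicator {K..} x \<partial>law n)"
      by (subst nn_integral_cmult_indicator) (simp_all add: sets_law)
    also have "\<dots> \<le> (\<integral>\<^sup>+x. ennreal x \<partial>law n)"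
      by (intro nn_integral_mono) (auto simp: indicator_def ennreal_leI)
    finally show ?thesis using mean_nonneg[of n] by (simp add: nn_mean ennreal_le_iff)
  qed
  finally have "1 / (m - 1) \<le> mean n - 1 / (m - 1)" by simp
  then have "1 / (m - 1) / m ^ n \<le> (mean n - 1 / (m - 1)) / m ^ n"
    using m by (intro divide_right_mono) auto
  then show ?thesis using mean_le_free_energy[of n] by linarith
qed

end

end

section \<open>Choice of the generation as a function of \<open>p\<close>, and the resulting
  exponent\<close>

section \<open>Asymptotics as p tends to 0\<close>

lemma eventually_cmult_powr_less:
  fixes e C D :: real
  assumes "0 < e" "0 < D"
  shows "\<forall>\<^sub>F p in at_right 0. C * p powr e < D"
proof -
  have "((\<lambda>p. C * p powr e) \<longlongrightarrow> C * 0) (at_right 0)"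
    using assms by (intro tendsto_mult tendsto_const tendsto_zero_powrI[where b = e])
      (auto intro!: tendsto_eq_intros simp: eventually_at_right_less less_imp_le eventually_at_filter)
  then show ?thesis using assms by (intro order_tendstoD(2)[where a = D]) auto
qed

text \<open>Cutting the half-line at the integers bounds the moment by a series whose terms are
  eventually dominated by a geometric one of ratio
  \<open>exp (- (\<theta> - \<theta>'))\<close>.\<close>

lemma exponential_moment_finite:
  fixes Q :: "real measure"
  assumes Q: "prob_space Q" "sets Q = sets borel" "AE y in Q. 0 \<le> y"
    and \<theta>: "0 < \<theta>'" "\<theta>' < \<theta>"
    and tail: "\<forall>\<^sub>F x in at_top. measure Q {x..} \<le> c * exp (- \<theta> * x)"
  shows "(\<integral>\<^sup>+y. ennreal (exp (\<theta>' * y)) \<partial>Q) < \<infinity>"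
proof -
  interpret Q: prob_space Q by (fact Q(1))
  note Q(2) [measurable_cong]
  let ?a = "\<lambda>k. exp (\<theta>' * (real k + 1)) * measure Q {real k..}"
  have "(\<integral>\<^sup>+y. ennreal (exp (\<theta>' * y)) \<partial>Q) \<le>
      (\<integral>\<^sup>+y. (\<Sum>k. ennreal (exp (\<theta>' * (real k + 1))) * indicator {real k..} y) \<partial>Q)"
  proof (rule nn_integral_mono_AE)
    show "AE y in Q. ennreal (exp (\<theta>' * y)) \<le>
        (\<Sum>k. ennreal (exp (\<theta>' * (real k + 1))) * indicator {real k..} y)"
      using Q(3)
    proof eventually_elim
      case (elim y)
      \<comment> \<open>The term at the integer part of \<open>y\<close> alone dominates the
        integrand.\<close>
      let ?k = "nat \<lfloor>y\<rfloor>"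
      let ?f = "\<lambda>k. ennreal (exp (\<theta>' * (real k + 1))) * indicator {real k..} y"
      have k: "real ?k \<le> y" "y \<le> real ?k + 1" using elim by linarith+
      then have "ennreal (exp (\<theta>' * y)) \<le> ?f ?k"
        using \<theta> by (simp add: ennreal_leI)
      also have "\<dots> = sum ?f {?k}" by (subst sum.insert) auto
      also have "\<dots> \<le> (\<Sum>k. ?f k)" by (rule sum_le_suminf) auto
      finally show ?case .
    qed
  qed
  also have "\<dots> = (\<Sum>k. \<integral>\<^sup>+y. ennreal (exp (\<theta>' * (real k + 1))) * indicator {real k..} y \<partial>Q)"
    by (rule nn_integral_suminf) (simp add: measurable_cong_sets[OF Q(2) refl])
  also have "\<dots> = (\<Sum>k. ennreal (?a k))"
    by (intro suminf_cong)
      (simp add: nn_integral_cmult_indicator Q(2) ennreal_mult Q.emeasure_eq_measure)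
  also have "\<dots> = ennreal (\<Sum>k. ?a k)"
  proof (rule suminf_ennreal2)
    show "summable ?a"
    proof (rule summable_comparison_test_ev)
      have "\<forall>\<^sub>F k :: nat in sequentially. measure Q {real k..} \<le> c * exp (- \<theta> * real k)"
        using filterlim_real_sequentially tail by (rule eventually_compose_filterlim[rotated])
      then show "\<forall>\<^sub>F k in sequentially. norm (?a k) \<le> c * exp \<theta>' * exp (- (\<theta> - \<theta>')) ^ k"
      proof eventually_elim
        case (elim k)
        have "norm (?a k) \<le> exp (\<theta>' * (real k + 1)) * (c * exp (- \<theta> * real k))"
          using elim by (simp add: mult_left_mono)
        also have "\<dots> = c * exp \<theta>' * exp (- (\<theta> - \<theta>')) ^ k"
          by (simp add: exp_of_nat_mult[symmetric] exp_add[symmetric] mult.assoc mult.left_commute[of _ c]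
              algebra_simps)
        finally show ?case .
      qed
      show "summable (\<lambda>k. c * exp \<theta>' * exp (- (\<theta> - \<theta>')) ^ k)"
        using \<theta> by (intro summable_mult summable_geometric) simp
    qed
  qed simp
  finally show ?thesis by (rule le_less_trans) simp
qed

context derrida_retaux
begin

text \<open>Takes about \<open>\<kappa> * (- ln p)\<close> generations, with \<open>\<kappa>\<close>
  such that \<open>m ^ L\<close> is of order \<open>p powr (- \<gamma>')\<close>. The condition on
  \<open>\<gamma>'\<close> says \<open>(ln m - \<theta>) * \<kappa> < 1\<close>, which makes the
  initial truncated moment tend to 0 with \<open>p\<close>.\<close>

lemma free_energy_upper_asymptotic:
  assumes \<theta>: "0 < \<theta>" "\<theta> < ln m"
    and tail: "\<forall>\<^sub>F x in at_top. measure Q {x..} \<le> c * exp (- \<theta> * x)"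
    and \<gamma>: "0 < \<gamma>" "\<gamma> < ln m / (ln m - \<theta>)"
  shows "\<forall>\<^sub>F p in at_right 0. free_energy N Q p \<le> p powr \<gamma>"
proof -
  \<comment> \<open>The gap between \<open>\<gamma>\<close> and \<open>\<gamma>'\<close> absorbs the
    multiplicative constants.\<close>
  obtain \<gamma>' where \<gamma>': "\<gamma> < \<gamma>'" "\<gamma>' < ln m / (ln m - \<theta>)" using dense[OF \<gamma>(2)] by auto
  define \<kappa> where "\<kappa> = \<gamma>' / ln m"
  have lnm: "0 < ln m" using \<theta> by linarith
  have \<kappa>: "0 < \<kappa>" "ln m * \<kappa> = \<gamma>'" using \<gamma> \<gamma>' lnm by (auto simp: \<kappa>_def)
  have \<kappa>1: "ln m - \<theta> < 1 / \<kappa>"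
    using \<gamma>'(2) \<gamma> \<gamma>' \<theta> lnm by (simp add: \<kappa>_def field_simps)
  \<comment> \<open>With \<open>s = ln m + d\<close> and \<open>\<theta>' = \<theta> - d\<close> the
    difference \<open>s - \<theta>'\<close> exceeds \<open>ln m - \<theta>\<close> by
    \<open>2 * d\<close>; the quarter keeps it below \<open>1 / \<kappa>\<close>, and the bound
    \<open>\<theta> / 2\<close> keeps \<open>\<theta>'\<close> positive.\<close>
  define d where "d = min (\<theta> / 2) ((1 / \<kappa> - (ln m - \<theta>)) / 4)"
  have d: "0 < d" "d < \<theta>" using \<theta> \<kappa>1 by (auto simp: d_def)
  have d4: "4 * d \<le> 1 / \<kappa> - (ln m - \<theta>)" by (simp add: d_def min_def)
  define s where "s = ln m + d"
  define \<theta>' where "\<theta>' = \<theta> - d"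
  have \<theta>': "0 < \<theta>'" "\<theta>' < \<theta>" "\<theta>' \<le> s" "0 < s" using d \<theta> by (auto simp: \<theta>'_def s_def)
  have s\<theta>: "(s - \<theta>') * \<kappa> < 1"
  proof -
    have "s - \<theta>' < 1 / \<kappa>" using d d4 by (simp add: s_def \<theta>'_def)
    then show ?thesis using \<kappa> by (simp add: field_simps)
  qed
  define E where "E = enn2real (\<integral>\<^sup>+y. ennreal (exp (\<theta>' * y)) \<partial>Q)"
  have E: "(\<integral>\<^sup>+y. ennreal (exp (\<theta>' * y)) \<partial>Q) = ennreal E"
    using exponential_moment_finite[OF prob_Q sets_Q nonneg_Q \<theta>'(1,2) tail] by (simp add: E_def)
  have E0: "0 \<le> E" by (simp add: E_def)
  have "exp (ln m) < exp s" using d by (simp add: s_def)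
  then have "m < exp s" using m by (simp only: exp_ln)
  then have "(\<integral>k. real k \<partial>N) < exp s" by (simp add: m_eq)
  then obtain \<delta> where \<delta>: "0 < \<delta>" "1 + \<delta> \<le> t" "chord_slope N (1 + \<delta>) < exp s"
    using chord_slope_right[OF sets_N t finite_measure_N] by blast
  have ev1: "\<forall>\<^sub>F p in at_right 0. s / \<theta>' * E * p powr (1 - (s - \<theta>') * \<kappa>) < \<delta>"
    using s\<theta> \<delta> by (intro eventually_cmult_powr_less) auto
  have ev2: "\<forall>\<^sub>F p in at_right 0. \<delta> / s * m * p powr (\<gamma>' - \<gamma>) < 1"
    using \<gamma>' by (intro eventually_cmult_powr_less) auto
  have ev3: "\<forall>\<^sub>F p :: real in at_right 0. p \<in> {0<..<1}"
    by (rule eventually_at_right_real) simp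
  show ?thesis
    using ev1 ev2 ev3
  proof eventually_elim
    case (elim p)
    have p: "0 < p" "p < 1" using elim by auto
    then have lnp: "0 \<le> - ln p" by simp
    define L where "L = nat \<lfloor>\<kappa> * (- ln p)\<rfloor>"
    have "0 \<le> \<kappa> * (- ln p)" using lnp \<kappa> by (intro mult_nonneg_nonneg) auto
    then have L: "real L \<le> \<kappa> * (- ln p)" "\<kappa> * (- ln p) - 1 \<le> real L"
      unfolding L_def by linarith+
    have "(\<integral>\<^sup>+y. ennreal (cut_exp s (real L) y - 1) \<partial>Q) \<le>
        (\<integral>\<^sup>+y. ennreal (s / \<theta>' * exp ((s - \<theta>') * real L)) * ennreal (exp (\<theta>' * y)) \<partial>Q)"
    proof (rule nn_integral_mono_AE)
      show "AE y in Q. ennreal (cut_exp s (real L) y - 1) \<le>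
          ennreal (s / \<theta>' * exp ((s - \<theta>') * real L)) * ennreal (exp (\<theta>' * y))"
        using nonneg_Q
      proof eventually_elim
        case (elim y)
        have "cut_exp s (real L) y - 1 \<le> s / \<theta>' * exp ((s - \<theta>') * real L) * exp (\<theta>' * y)"
          using cut_exp_le[OF \<theta>'(1,3) elim, of "real L"] by linarith
        then show ?case using \<theta>' by (subst ennreal_mult[symmetric]) (auto intro!: ennreal_leI)
      qed
    qed
    also have "\<dots> = ennreal (s / \<theta>' * exp ((s - \<theta>') * real L)) * ennreal E"
      by (subst nn_integral_cmult) (simp_all add: E measurable_cong_sets[OF sets_Q refl])
    also have "\<dots> = ennreal (s / \<theta>' * exp ((s - \<theta>') * real L) * E)"
      using \<theta>' E0 by (subst ennreal_mult) auto
    finally have "ennreal p * (\<integral>\<^sup>+y. ennreal (cut_exp s (real L) y - 1) \<partial>Q) \<le>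
        ennreal p * ennreal (s / \<theta>' * exp ((s - \<theta>') * real L) * E)"
      by (intro mult_left_mono) auto
    also have "\<dots> = ennreal (p * (s / \<theta>' * exp ((s - \<theta>') * real L) * E))"
      using p \<theta>' E0 by (subst ennreal_mult) auto
    also have "\<dots> \<le> ennreal \<delta>"
    proof (rule ennreal_leI)
      have "(s - \<theta>') * real L \<le> (s - \<theta>') * (\<kappa> * (- ln p))"
        using L(1) \<theta>' by (intro mult_left_mono) auto
      then have "exp ((s - \<theta>') * real L) \<le> exp ((s - \<theta>') * (\<kappa> * (- ln p)))" by simp
      also have "\<dots> = p powr (- ((s - \<theta>') * \<kappa>))"
        using p by (simp add: powr_def)
      finally have "p * (s / \<theta>' * exp ((s - \<theta>') * real L) * E) \<le>
          p * (s / \<theta>' * p powr (- ((s - \<theta>') * \<kappa>)) * E)"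
        using p \<theta>' E0 by (intro mult_left_mono mult_right_mono) auto
      also have "\<dots> = s / \<theta>' * E * (p powr 1 * p powr (- ((s - \<theta>') * \<kappa>)))"
        using p by simp
      also have "\<dots> = s / \<theta>' * E * p powr (1 - (s - \<theta>') * \<kappa>)"
        by (subst powr_add[symmetric]) simp
      finally show "p * (s / \<theta>' * exp ((s - \<theta>') * real L) * E) \<le> \<delta>"
        using elim(1) by linarith
    qed
    finally have "free_energy N Q p \<le> \<delta> / s / m ^ L"
      using p \<theta>' \<delta> by (intro free_energy_upper) auto
    \<comment> \<open>Rounding \<open>L\<close> down loses at most one generation, hence the factor
      \<open>m\<close>.\<close>
    also have "\<dots> \<le> \<delta> / s * (m * p powr \<gamma>')"
    proof -
      have "ln m * (\<kappa> * (- ln p) - 1) \<le> ln m * real L"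
        using L(2) lnm by (intro mult_left_mono) auto
      also have "ln m * (\<kappa> * (- ln p) - 1) = - (ln m + \<gamma>' * ln p)"
        using \<kappa>(2) by (simp add: algebra_simps mult.assoc[symmetric])
      finally have "exp (- (ln m * real L)) \<le> exp (ln m + \<gamma>' * ln p)" by simp
      also have "\<dots> = m * p powr \<gamma>'" using p m by (simp add: exp_add powr_def)
      also have "exp (- (ln m * real L)) = 1 / m ^ L"
        using m by (simp add: exp_minus mult.commute[of "ln m"] exp_of_nat_mult inverse_eq_divide)
      finally have "\<delta> / s * (1 / m ^ L) \<le> \<delta> / s * (m * p powr \<gamma>')"
        using \<delta> \<theta>' by (intro mult_left_mono) auto
      then show ?thesis by simp
    qed
    also have "p powr \<gamma>' = p powr (\<gamma>' - \<gamma>) * p powr \<gamma>"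
      by (subst powr_add[symmetric]) simp
    also have "\<delta> / s * (m * (p powr (\<gamma>' - \<gamma>) * p powr \<gamma>)) =
        (\<delta> / s * m * p powr (\<gamma>' - \<gamma>)) * p powr \<gamma>" by simp
    also have "\<dots> \<le> 1 * p powr \<gamma>"
      using elim(2) by (intro mult_right_mono) auto
    finally show ?case by simp
  qed
qed

text \<open>With growth factor \<open>exp (\<theta> + h)\<close>, the factor
  \<open>exp (- \<theta> * n)\<close> lost in the initial tail is compensated and a net rate
  \<open>h\<close> remains. Level \<open>\<delta>\<close> is thus reached after about
  \<open>- ln p / h\<close> generations, and any \<open>h\<close> below
  \<open>ln m - \<theta>\<close> is available.\<close>

lemma free_energy_lower_asymptotic:
  assumes \<theta>: "0 < \<theta>" "\<theta> < ln m" and c: "0 < c"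
    and tail: "\<forall>\<^sub>F x in at_top. c * exp (- \<theta> * x) \<le> measure Q {x..}"
    and \<gamma>: "ln m / (ln m - \<theta>) < \<gamma>"
  shows "\<forall>\<^sub>F p in at_right 0. p powr \<gamma> \<le> free_energy N Q p"
proof -
  obtain \<gamma>' where \<gamma>': "\<gamma>' < \<gamma>" "ln m / (ln m - \<theta>) < \<gamma>'" using dense[OF \<gamma>] by auto
  have lnm: "0 < ln m" using \<theta> by linarith
  have "0 < ln m / (ln m - \<theta>)" using lnm \<theta> by simp
  then have \<gamma>'0: "0 < \<gamma>'" using \<gamma>' by linarith
  \<comment> \<open>Chosen so that \<open>m\<close> to the power \<open>- ln p / h\<close> is
    \<open>p powr (- \<gamma>')\<close>; the lower bound on \<open>\<gamma>'\<close> becomes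
    \<open>h < ln m - \<theta>\<close>, that is \<open>b < m\<close>.\<close>
  define h where "h = ln m / \<gamma>'"
  have h: "0 < h" "h < ln m - \<theta>" "h * \<gamma>' = ln m"
    using \<gamma>' \<gamma>'0 lnm \<theta> by (auto simp: h_def field_simps)
  define b where "b = exp (\<theta> + h)"
  have b1: "1 \<le> b" using \<theta> h by (simp add: b_def)
  have "b < exp (ln m)" using h by (simp add: b_def)
  then have "b < (\<integral>k. real k \<partial>N)" using m by (simp add: m_eq)
  then obtain \<delta> where \<delta>: "0 < \<delta>" "\<delta> \<le> 1" "b < chord_slope N (1 - \<delta>)"
    using chord_slope_left[OF sets_N t finite_measure_N] by blast
  define K where "K = 2 / (m - 1) / \<delta>"
  have K: "0 < K" "2 / (m - 1) \<le> \<delta> * K" using m \<delta> by (auto simp: K_def)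
  \<comment> \<open>Solving \<open>b ^ n * p * c * exp (- \<theta> * (K + n)) \<ge> \<delta>\<close>
    in logarithms gives \<open>h * n \<ge> - ln p + A\<close>.\<close>
  define A where "A = \<theta> * K + ln \<delta> - ln c"
  obtain x0 where x0: "\<And>x. x0 \<le> x \<Longrightarrow> c * exp (- \<theta> * x) \<le> measure Q {x..}"
    using tail by (auto simp: eventually_at_top_linorder)
  \<comment> \<open>Collects the prefactor, the shift \<open>A\<close> of the time, and a factor
    \<open>1 / m\<close> for rounding \<open>n\<close> up.\<close>
  define B where "B = 1 / (m - 1) * exp (- (\<gamma>' * A)) / m"
  have B: "0 < B" using m by (simp add: B_def)
  have ev1: "\<forall>\<^sub>F p in at_right 0. 1 * p powr (\<gamma> - \<gamma>') < B"
    using \<gamma>' B by (intro eventually_cmult_powr_less) auto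
  \<comment> \<open>Makes \<open>- ln p + A\<close> nonnegative and at least \<open>h * x0\<close>,
    so that \<open>n\<close> lies beyond the point from which the tail bound holds.\<close>
  have ev2: "\<forall>\<^sub>F p :: real in at_right 0. ln p < - max 0 (h * x0) - \<bar>A\<bar>"
    using ln_at_0 by (simp add: filterlim_at_bot_dense)
  have ev3: "\<forall>\<^sub>F p :: real in at_right 0. p \<in> {0<..<1}"
    by (rule eventually_at_right_real) simp
  show ?thesis
    using ev1 ev2 ev3
  proof eventually_elim
    case (elim p)
    have p: "0 < p" "p < 1" using elim by auto
    define n where "n = nat \<lceil>(- ln p + A) / h\<rceil>"
    have "0 \<le> - ln p + A" "h * x0 \<le> - ln p + A" using elim(2) by linarith+
    then have "0 \<le> (- ln p + A) / h" and x0n: "x0 \<le> (- ln p + A) / h"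
      using h by (auto simp: field_simps)
    then have n: "(- ln p + A) / h \<le> real n" "real n \<le> (- ln p + A) / h + 1"
      unfolding n_def by linarith+
    have "\<delta> \<le> b ^ n * (p * measure Q {K + real n..})"
    proof -
      have "ln \<delta> \<le> real n * (\<theta> + h) + (ln p + (ln c - \<theta> * (K + real n)))"
        using n(1) h by (simp add: A_def field_simps)
      then have "exp (ln \<delta>) \<le> exp (real n * (\<theta> + h) + (ln p + (ln c - \<theta> * (K + real n))))"
        by simp
      also have "\<dots> = exp (real n * (\<theta> + h)) * (exp (ln p) * (exp (ln c) * exp (- \<theta> * (K + real n))))"
        by (simp add: exp_add[symmetric] algebra_simps)
      also have "\<dots> = b ^ n * (p * (c * exp (- \<theta> * (K + real n))))"
        using p c by (simp add: b_def exp_of_nat_mult)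
      also have "\<dots> \<le> b ^ n * (p * measure Q {K + real n..})"
        using p b1 x0n n(1) K x0[of "K + real n"] by (intro mult_left_mono) auto
      finally show ?thesis using \<delta> by simp
    qed
    then have "1 / (m - 1) / m ^ n \<le> free_energy N Q p"
      using p \<delta> b1 K by (intro free_energy_lower[where b = b and \<delta> = \<delta> and K = K]) auto
    moreover have "B * p powr \<gamma>' \<le> 1 / (m - 1) / m ^ n"
    proof -
      have "ln m * real n \<le> ln m * ((- ln p + A) / h + 1)"
        using n(2) lnm by (intro mult_left_mono) auto
      also have "\<dots> = - (\<gamma>' * ln p) + \<gamma>' * A + ln m"
        using h(1) by (simp add: h(3)[symmetric] field_simps)
      finally have "exp (\<gamma>' * ln p + - (\<gamma>' * A) - ln m) \<le> exp (- (ln m * real n))" by simp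
      also have "exp (- (ln m * real n)) = 1 / m ^ n"
        using m by (simp add: exp_minus mult.commute[of "ln m"] exp_of_nat_mult inverse_eq_divide)
      also have "exp (\<gamma>' * ln p + - (\<gamma>' * A) - ln m) = p powr \<gamma>' * exp (- (\<gamma>' * A)) / m"
        using p m by (simp add: exp_diff exp_add powr_def del: exp_minus) (simp add: exp_minus field_simps)
      finally have "1 / (m - 1) * (p powr \<gamma>' * exp (- (\<gamma>' * A)) / m) \<le> 1 / (m - 1) * (1 / m ^ n)"
        using m by (intro mult_left_mono) auto
      then show ?thesis by (simp add: B_def mult_ac)
    qed
    moreover have "p powr \<gamma> \<le> B * p powr \<gamma>'"
    proof -
      have "p powr \<gamma> = p powr (\<gamma> - \<gamma>') * p powr \<gamma>'"
        by (subst powr_add[symmetric]) simp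
      also have "\<dots> \<le> B * p powr \<gamma>'"
        using elim(1) by (intro mult_right_mono) auto
      finally show ?thesis .
    qed
    ultimately show ?case by linarith
  qed
qed

end

text \<open>The exponent is \<open>ln (F p) / ln p\<close>. Since \<open>ln p < 0\<close>, upper
  bounds on \<open>F\<close> bound it from below and lower bounds on \<open>F\<close> from above;
  the lower bounds also make \<open>F\<close> eventually positive, so its logarithm is
  meaningful.\<close>

lemma powr_exponent_tendsto:
  fixes F :: "real \<Rightarrow> real"
  assumes \<beta>: "0 < \<beta>"
    and upper: "\<And>\<gamma>. 0 < \<gamma> \<Longrightarrow> \<gamma> < \<beta> \<Longrightarrow> \<forall>\<^sub>F p in at_right 0. F p \<le> p powr \<gamma>"
    and lower: "\<And>\<gamma>. \<beta> < \<gamma> \<Longrightarrow> \<forall>\<^sub>F p in at_right 0. p powr \<gamma> \<le> F p"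
  shows "\<exists>\<epsilon> :: real \<Rightarrow> real. (\<epsilon> \<longlongrightarrow> 0) (at_right 0) \<and>
    (\<forall>\<^sub>F p in at_right 0. F p = p powr (\<beta> + \<epsilon> p))"
proof (intro exI conjI)
  let ?\<epsilon> = "\<lambda>p. ln (F p) / ln p - \<beta>"
  have ev: "\<forall>\<^sub>F p :: real in at_right 0. p \<in> {0<..<1}"
    by (rule eventually_at_right_real) simp
  have pos: "\<forall>\<^sub>F p in at_right 0. 0 < F p"
    using lower[of "\<beta> + 1", simplified] ev
  proof eventually_elim
    case (elim p)
    then have "0 < p powr (\<beta> + 1)" by simp
    then show ?case using elim by linarith
  qed
  show "\<forall>\<^sub>F p in at_right 0. F p = p powr (\<beta> + ?\<epsilon> p)"
    using pos ev by eventually_elim (simp add: powr_def)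
  have "((\<lambda>p. ln (F p) / ln p) \<longlongrightarrow> \<beta>) (at_right 0)"
  proof (rule order_tendstoI)
    fix l assume "l < \<beta>"
    \<comment> \<open>The maximum with 0 is there because \<open>upper\<close> speaks only of
      positive exponents.\<close>
    then obtain \<gamma> where \<gamma>: "max l 0 < \<gamma>" "\<gamma> < \<beta>"
      using dense[of "max l 0" \<beta>] \<beta> by auto
    have "\<forall>\<^sub>F p in at_right 0. F p \<le> p powr \<gamma>" using upper \<gamma> by simp
    then show "\<forall>\<^sub>F p in at_right 0. l < ln (F p) / ln p"
      using pos ev
    proof eventually_elim
      case (elim p)
      have neg: "ln p < 0" using elim by simp
      have "ln (F p) \<le> ln (p powr \<gamma>)"
        using elim by (subst ln_le_cancel_iff) auto
      with elim have "ln (F p) \<le> \<gamma> * ln p" by (simp add: ln_powr)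
      with neg have "\<gamma> \<le> ln (F p) / ln p" by (simp add: field_simps)
      then show ?case using \<gamma> by simp
    qed
  next
    fix u assume "\<beta> < u"
    then obtain \<gamma> where \<gamma>: "\<beta> < \<gamma>" "\<gamma> < u" using dense by blast
    show "\<forall>\<^sub>F p in at_right 0. ln (F p) / ln p < u"
      using lower[OF \<gamma>(1)] pos ev
    proof eventually_elim
      case (elim p)
      have neg: "ln p < 0" using elim by simp
      have "ln (p powr \<gamma>) \<le> ln (F p)"
        using elim by (subst ln_le_cancel_iff) auto
      with elim have "\<gamma> * ln p \<le> ln (F p)" by (simp add: ln_powr)
      with neg have "ln (F p) / ln p \<le> \<gamma>" by (simp add: field_simps)
      then show ?case using \<gamma> by simp
    qed
  qed
  then have "((\<lambda>p. ln (F p) / ln p - \<beta>) \<longlongrightarrow> \<beta> - \<beta>) (at_right 0)"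
    by (intro tendsto_diff) auto
  then show "(?\<epsilon> \<longlongrightarrow> 0) (at_right 0)" by simp
qed

theorem theorem1p4:
  fixes M :: "'a measure" and \<nu> :: "'a \<Rightarrow> nat"
    and M' :: "'b measure" and Y\<^sub>0 :: "'b \<Rightarrow> real"
    and m \<theta> \<beta> c\<^sub>1 c\<^sub>2 :: real
  assumes "prob_space M" and "\<nu> \<in> M \<rightarrow>\<^sub>M count_space UNIV"
    and "\<And>\<omega>. \<omega> \<in> space M \<Longrightarrow> 1 \<le> \<nu> \<omega>"
    and "\<exists>t>1. integrable M (\<lambda>\<omega>. (t :: real) ^ \<nu> \<omega>)"
    and "m = prob_space.expectation M (\<lambda>\<omega>. real (\<nu> \<omega>))" and "1 < m"
    and "0 < \<theta>" and "\<theta> < ln m"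
    and "prob_space M'" and "Y\<^sub>0 \<in> M' \<rightarrow>\<^sub>M borel"
    and "\<And>\<omega>. \<omega> \<in> space M' \<Longrightarrow> 0 < Y\<^sub>0 \<omega>"
    and "0 < c\<^sub>1" and "c\<^sub>1 \<le> c\<^sub>2"
    and "\<forall>\<^sub>F x in at_top. c\<^sub>1 * exp (- \<theta> * x) \<le> \<P>(\<omega> in M'. Y\<^sub>0 \<omega> \<ge> x) \<and>
           \<P>(\<omega> in M'. Y\<^sub>0 \<omega> \<ge> x) \<le> c\<^sub>2 * exp (- \<theta> * x)"
    and "\<beta> = ln m / (ln m - \<theta>)"
  shows "\<exists>\<epsilon> :: real \<Rightarrow> real. (\<epsilon> \<longlongrightarrow> 0) (at_right 0) \<and>
    (\<forall>\<^sub>F p in at_right 0.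
       free_energy (distr M (count_space UNIV) \<nu>) (distr M' borel Y\<^sub>0) p = p powr (\<beta> + \<epsilon> p))"
proof -
  let ?N = "distr M (count_space UNIV) \<nu>" and ?Q = "distr M' borel Y\<^sub>0"
  note \<nu> = assms(2) and Y = assms(10) and \<theta> = assms(7,8)
  obtain t :: real where t: "1 < t" "integrable M (\<lambda>\<omega>. t ^ \<nu> \<omega>)" using assms(4) by auto
  have Q: "prob_space ?Q" "AE y in ?Q. 0 \<le> y"
    using assms(9,11) Y
    by (auto intro: prob_space.prob_space_distr simp: AE_distr_iff less_imp_le)
  have tail_eq: "measure ?Q {x..} = \<P>(\<omega> in M'. Y\<^sub>0 \<omega> \<ge> x)" for x
  proof -
    have "Y\<^sub>0 -` {x..} \<inter> space M' = {\<omega> \<in> space M'. Y\<^sub>0 \<omega> \<ge> x}" by auto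
    then show ?thesis using Y by (simp add: measure_distr)
  qed
  have upper: "\<forall>\<^sub>F x in at_top. measure ?Q {x..} \<le> c\<^sub>2 * exp (- \<theta> * x)"
    and lower: "\<forall>\<^sub>F x in at_top. c\<^sub>1 * exp (- \<theta> * x) \<le> measure ?Q {x..}"
    using assms(14) unfolding tail_eq by (auto elim!: eventually_mono)
  \<comment> \<open>The mean is finite because \<open>y\<close> is at most a constant times
    \<open>exp (\<theta> / 2 * y)\<close>, and \<open>\<theta> / 2\<close> lies below the tail
    exponent.\<close>
  have "(\<integral>\<^sup>+y. ennreal y \<partial>?Q) \<le> (\<integral>\<^sup>+y. ennreal (2 / \<theta>) * ennreal (exp (\<theta> / 2 * y)) \<partial>?Q)"
  proof (rule nn_integral_mono)
    fix y
    have "\<theta> / 2 * y \<le> exp (\<theta> / 2 * y)" using exp_ge_add_one_self[of "\<theta> / 2 * y"] by linarith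
    then have "y \<le> 2 / \<theta> * exp (\<theta> / 2 * y)" using \<theta> by (simp add: field_simps)
    then have "ennreal y \<le> ennreal (2 / \<theta> * exp (\<theta> / 2 * y))" by (rule ennreal_leI)
    then show "ennreal y \<le> ennreal (2 / \<theta>) * ennreal (exp (\<theta> / 2 * y))"
      using \<theta> by (subst ennreal_mult[symmetric]) auto
  qed
  also have "\<dots> = ennreal (2 / \<theta>) * (\<integral>\<^sup>+y. ennreal (exp (\<theta> / 2 * y)) \<partial>?Q)"
    by (rule nn_integral_cmult) simp
  also have "\<dots> < \<infinity>"
    using exponential_moment_finite[OF Q(1) _ Q(2) _ _ upper, of "\<theta> / 2"] \<theta>
    by (simp add: ennreal_mult_less_top)
  finally have finite_mean: "(\<integral>\<^sup>+y. ennreal y \<partial>?Q) < \<infinity>" .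
  interpret derrida_retaux ?N ?Q t m
  proof (rule derrida_retaux.intro)
    show "prob_space ?N" using assms(1) \<nu> by (rule prob_space.prob_space_distr)
    show "m = (\<integral>k. real k \<partial>?N)" using assms(5) \<nu> by (simp add: integral_distr)
    show "integrable ?N (\<lambda>k. t ^ k)" using t \<nu> by (simp add: integrable_distr_eq)
  qed (simp_all only: sets_distr t(1) assms(6) Q finite_mean)
  show ?thesis
  proof (rule powr_exponent_tendsto)
    show "0 < \<beta>" using assms(15) \<theta> by simp
    show "\<forall>\<^sub>F p in at_right 0. free_energy ?N ?Q p \<le> p powr \<gamma>" if "0 < \<gamma>" "\<gamma> < \<beta>" for \<gamma>
      using free_energy_upper_asymptotic[OF \<theta> upper that(1)] that(2) assms(15) by simp
    show "\<forall>\<^sub>F p in at_right 0. p powr \<gamma> \<le> free_energy ?N ?Q p" if "\<beta> < \<gamma>" for \<gamma>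
      using free_energy_lower_asymptotic[OF \<theta> assms(12) lower] that assms(15) by simp
  qed
qed

end
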